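(* Let $\mathcal{G}=(\Gamma,G)$ be a locally finite nonsingular graph of countable groups with $\Gamma^1\neq\emptyset$, and let $v\in\Gamma^0$. The action of $\pi_1(\mathcal{G},v)$ on $v\partial X_{\mathcal{G}}$ is not minimal if and only if one of the following holds: (c') there is an edge $e\in\Gamma^1$ such that $\alpha_{\overline e}$ is surjective, $e$ does not lie on any minimal cycle of $\Gamma$, $\mathcal{G}$ is treelike at $e$, and there exists $\xi\in r(e)\partial W_{\mathcal{G}}$ such that $e$ does not lie on $\xi$; or (d) $\Gamma$ is a minimal cycle $e_1e_2\cdots e_n$ (i.e. $e_1\cdots e_n$, $n\ge1$, is a minimal cycle and $\Gamma^1=\{e_i,\overline{e_i}:1\le i\le n\}$) such that $\alpha_{\overline{e_i}}$ is surjective for all $i$.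
   Context: Graphs. A graph $\Gamma=(\Gamma^0,\Gamma^1,r,s)$ consists of countable sets $\Gamma^0$ (vertices) and $\Gamma^1$ (edges), maps $r,s:\Gamma^1\to\Gamma^0$ (range, source), and a map $e\mapsto\overline e$ on $\Gamma^1$ with $\overline e\neq e$, $\overline{\overline e}=e$, $s(e)=r(\overline e)$. A path of length $n\ge1$ is $e_1\cdots e_n$ with $s(e_i)=r(e_{i+1})$; range $r(e_1)$, source $s(e_n)$; vertices are paths of length $0$. It is reduced if $e_{i+1}\ne\overline{e_i}$ for all $i$. $x\Gamma^*y$ is the set of reduced paths with range $x$ and source $y$. A minimal cycle is a reduced path $e_1\cdots e_n$ with range equal to source and with the vertices $r(e_i)$ pairwise distinct. A tree is a connected graph in which any two vertices are joined by a unique reduced path; in a tree, an edge $f$ points towards a vertex $x$ if the unique reduced path with range $x$ and source $r(f)$ does not contain $f$. Graphs of groups. A graph of groups $\mathcal{G}=(\Gamma,G)$ consists of a connected graph $\Gamma$, groups $G_x$ ($x\in\Gamma^0$) and $G_e=G_{\overline e}$ ($e\in\Gamma^1$), and monomorphisms $\alpha_e:G_e\to G_{r(e)}$. It is locally finite if $|r^{-1}(x)|<\infty$ for all $x$ and $[G_{r(e)}:\alpha_e(G_e)]<\infty$ for all $e$; nonsingular if $[G_{r(e)}:\alpha_e(G_e)]>1$ whenever $r^{-1}(r(e))=\{e\}$; a graph of countable groups if every $G_x$ is countable. For each $e$ fix a transversal $\Sigma_e\ni1$ for $G_{r(e)}/\alpha_e(G_e)$. Words. A $\mathcal{G}$-word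 is a sequence $g_1$, or $g_1e_1\cdots g_ne_n$, or $g_1e_1\cdots g_ne_ng_{n+1}$ with $s(e_i)=r(e_{i+1})$, $g_j\in G_{r(e_j)}$, $g_{n+1}\in G_{s(e_n)}$ (and $g_1$ in some vertex group if $n=0$); range $r(e_1)$, source $s(e_n)$, length $n$. It is reduced if (for $n>0$) $g_j\in\Sigma_{e_j}$ for $1\le j\le n$ and $g_{i+1}\ne1$ whenever $e_i=\overline{e_{i+1}}$ ($g_{n+1}$ arbitrary). A $\mathcal{G}$-path is a reduced $\mathcal{G}$-word $1_x$ or $g_1e_1\cdots g_ne_n$. $\pi_1(\mathcal{G},v)$ is the group of $\mathcal{G}$-words with range and source $v$ modulo the relations of the vertex groups and the relations $e\overline e=1_{r(e)}$, $e\,\alpha_{\overline e}(g)=\alpha_e(g)\,e$ ($g\in G_e$), under concatenation; each class contains a unique reduced $\mathcal{G}$-word. Boundary. An infinite reduced $\mathcal{G}$-path is a sequence $g_1e_1g_2e_2\cdots$ all of whose initial segments $g_1e_1\cdots g_ne_n$ are $\mathcal{G}$-paths; its range is $r(e_1)$. $x\partial W_{\mathcal{G}}$ is the set of those with range $x$, and $v\partial X_{\mathcal{G}}=v\partial W_{\mathcal{G}}$, with topology having base the sets $Z(\mu)$ of extensions of $\mathcal{G}$-paths $\mu$ with range $v$. $\pi_1(\mathcal{G},v)$ acts on $v\partial X_{\mathcal{G}}$ by concatenation followed by reduction. An edge $e$ lies on $h_1f_1h_2f_2\cdots$ if $e=f_i$ for some $i$. An action is minimal if every orbit is dense. Treelike.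 If $s(e)\ne r(e)$, $E_{s,e}$ is the subgraph of $\Gamma$ whose vertices are $s(e)$ and all $x$ for which there is a reduced path $e_1\cdots e_n\in s(e)\Gamma^*x$ with $e_1\ne\overline e$, and whose edges are the edges appearing on these paths together with their reversals. If $s(e)=r(e)$, $E_{s,e}$ is defined the same way with the condition $e_1\notin\{e,\overline e\}$. $\mathcal{G}$ is treelike at the edge $e$ if $E_{s,e}$ is a tree and $\alpha_{\overline f}$ is onto for each edge $f$ of $E_{s,e}$ that points towards $s(e)$.
   Formalization: "f points towards x" is read as: the reduced path with range x and source r(f) contains neither f nor its reversal; read for the oriented edge f alone the condition always holds in a tree, and the theorem fails for a line of groups Z with index-2 inclusions. *)

theory Defs
  imports
    "HOL-Library.Countable_Set"
    "HOL-Analysis.Abstract_Topology"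
    "HOL-Algebra.Left_Coset"
    "HOL-Algebra.Group_Action"
begin

section \<open>Graphs in the sense of Serre\<close>

record ('v, 'e) sgraph =
  verts :: "'v set"
  edges :: "'e set"
  rng :: "'e \<Rightarrow> 'v"
  src :: "'e \<Rightarrow> 'v"
  bar :: "'e \<Rightarrow> 'e"

locale sgraph =
  fixes \<Gamma> :: "('v, 'e, 'z) sgraph_scheme"
  assumes countable_verts: "countable (verts \<Gamma>)"
    and countable_edges: "countable (edges \<Gamma>)"
    and rng_in: "e \<in> edges \<Gamma> \<Longrightarrow> rng \<Gamma> e \<in> verts \<Gamma>"
    and src_in: "e \<in> edges \<Gamma> \<Longrightarrow> src \<Gamma> e \<in> verts \<Gamma>"
    and bar_in: "e \<in> edges \<Gamma> \<Longrightarrow> bar \<Gamma> e \<in> edges \<Gamma>"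
    and bar_neq: "e \<in> edges \<Gamma> \<Longrightarrow> bar \<Gamma> e \<noteq> e"
    and bar_bar: "e \<in> edges \<Gamma> \<Longrightarrow> bar \<Gamma> (bar \<Gamma> e) = e"
    and src_eq: "e \<in> edges \<Gamma> \<Longrightarrow> src \<Gamma> e = rng \<Gamma> (bar \<Gamma> e)"

text \<open>\<open>is_path \<Gamma> x es y\<close>: the edge sequence \<open>es\<close> is a path with range \<open>x\<close> and source \<open>y\<close>.
  The empty sequence, with \<open>x = y\<close>, stands for the vertex \<open>x\<close> as a path of length 0.\<close>

fun is_path :: "('v, 'e, 'z) sgraph_scheme \<Rightarrow> 'v \<Rightarrow> 'e list \<Rightarrow> 'v \<Rightarrow> bool" where
  "is_path \<Gamma> x [] y \<longleftrightarrow> x = y \<and> x \<in> verts \<Gamma>"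
| "is_path \<Gamma> x (e # es) y \<longleftrightarrow> e \<in> edges \<Gamma> \<and> rng \<Gamma> e = x \<and> is_path \<Gamma> (src \<Gamma> e) es y"

definition reduced :: "('v, 'e, 'z) sgraph_scheme \<Rightarrow> 'e list \<Rightarrow> bool" where
  "reduced \<Gamma> es \<longleftrightarrow> (\<forall>i. Suc i < length es \<longrightarrow> es ! Suc i \<noteq> bar \<Gamma> (es ! i))"

definition rpaths :: "('v, 'e, 'z) sgraph_scheme \<Rightarrow> 'v \<Rightarrow> 'v \<Rightarrow> 'e list set" where
  "rpaths \<Gamma> x y = {es. is_path \<Gamma> x es y \<and> reduced \<Gamma> es}"

definition minimal_cycle :: "('v, 'e, 'z) sgraph_scheme \<Rightarrow> 'e list \<Rightarrow> bool" where
  "minimal_cycle \<Gamma> es \<longleftrightarrow>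
     es \<noteq> [] \<and> (\<exists>x. es \<in> rpaths \<Gamma> x x) \<and> distinct (map (rng \<Gamma>) es)"

definition connected_graph :: "('v, 'e, 'z) sgraph_scheme \<Rightarrow> bool" where
  "connected_graph \<Gamma> \<longleftrightarrow> (\<forall>x \<in> verts \<Gamma>. \<forall>y \<in> verts \<Gamma>. \<exists>es. is_path \<Gamma> x es y)"

definition is_tree :: "('v, 'e, 'z) sgraph_scheme \<Rightarrow> bool" where
  "is_tree \<Gamma> \<longleftrightarrow> sgraph \<Gamma> \<and> connected_graph \<Gamma> \<and>
     (\<forall>x \<in> verts \<Gamma>. \<forall>y \<in> verts \<Gamma>. \<exists>!es. es \<in> rpaths \<Gamma> x y)"

text \<open>In a tree, \<open>f\<close> points towards \<open>x\<close> if the reduced path joining \<open>x\<close> and \<open>r(f)\<close> does not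
  contain the edge \<open>f\<close>, in either orientation. Both orientations have to be excluded: a reduced
  path in a tree with source \<open>r(f)\<close> never traverses \<open>f\<close> itself in its own direction, and the
  path runs through \<open>bar f\<close> exactly when \<open>f\<close> points away from \<open>x\<close>.\<close>

definition points_towards :: "('v, 'e, 'z) sgraph_scheme \<Rightarrow> 'e \<Rightarrow> 'v \<Rightarrow> bool" where
  "points_towards T f x \<longleftrightarrow>
     (\<forall>es \<in> rpaths T x (rng T f). f \<notin> set es \<and> bar T f \<notin> set es)"


section \<open>Graphs of groups\<close>

text \<open>All vertex groups live in one type \<open>'g\<close> and all edge groups in one type \<open>'h\<close>; their
  carriers may overlap.\<close>

record ('v, 'e, 'g, 'h) gog = "('v, 'e) sgraph" +
  vgrp :: "'v \<Rightarrow> 'g monoid"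
  egrp :: "'e \<Rightarrow> 'h monoid"
  emb :: "'e \<Rightarrow> 'h \<Rightarrow> 'g"

abbreviation emb_image :: "('v, 'e, 'g, 'h) gog \<Rightarrow> 'e \<Rightarrow> 'g set" where
  "emb_image \<G> e \<equiv> emb \<G> e ` carrier (egrp \<G> e)"

locale graph_of_groups = sgraph \<G> for \<G> :: "('v, 'e, 'g, 'h) gog" +
  assumes connected: "connected_graph \<G>"
    and vgrp_group: "x \<in> verts \<G> \<Longrightarrow> group (vgrp \<G> x)"
    and egrp_group: "e \<in> edges \<G> \<Longrightarrow> group (egrp \<G> e)"
    and egrp_bar: "e \<in> edges \<G> \<Longrightarrow> egrp \<G> (bar \<G> e) = egrp \<G> e"
    and emb_mon: "e \<in> edges \<G> \<Longrightarrow> emb \<G> e \<in> mon (egrp \<G> e) (vgrp \<G> (rng \<G> e))"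

definition locally_finite :: "('v, 'e, 'g, 'h) gog \<Rightarrow> bool" where
  "locally_finite \<G> \<longleftrightarrow>
     (\<forall>x \<in> verts \<G>. finite {e \<in> edges \<G>. rng \<G> e = x}) \<and>
     (\<forall>e \<in> edges \<G>. finite (lcosets\<^bsub>vgrp \<G> (rng \<G> e)\<^esub> (emb_image \<G> e)))"

text \<open>An index is never 0, and \<open>card\<close> is 0 on infinite sets, so index greater than 1 is
  expressed by \<open>card \<noteq> 1\<close>.\<close>

definition nonsingular :: "('v, 'e, 'g, 'h) gog \<Rightarrow> bool" where
  "nonsingular \<G> \<longleftrightarrow>
     (\<forall>e \<in> edges \<G>. {f \<in> edges \<G>. rng \<G> f = rng \<G> e} = {e} \<longrightarrow>
        card (lcosets\<^bsub>vgrp \<G> (rng \<G> e)\<^esub> (emb_image \<G> e)) \<noteq> 1)"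

definition countable_groups :: "('v, 'e, 'g, 'h) gog \<Rightarrow> bool" where
  "countable_groups \<G> \<longleftrightarrow> (\<forall>x \<in> verts \<G>. countable (carrier (vgrp \<G> x)))"

definition emb_onto :: "('v, 'e, 'g, 'h) gog \<Rightarrow> 'e \<Rightarrow> bool" where
  "emb_onto \<G> e \<longleftrightarrow> emb_image \<G> e = carrier (vgrp \<G> (rng \<G> e))"

definition transversals :: "('v, 'e, 'g, 'h) gog \<Rightarrow> ('e \<Rightarrow> 'g set) \<Rightarrow> bool" where
  "transversals \<G> S \<longleftrightarrow>
     (\<forall>e \<in> edges \<G>. S e \<subseteq> carrier (vgrp \<G> (rng \<G> e)) \<and>
        \<one>\<^bsub>vgrp \<G> (rng \<G> e)\<^esub> \<in> S e \<and>
        (\<forall>C \<in> lcosets\<^bsub>vgrp \<G> (rng \<G> e)\<^esub> (emb_image \<G> e). \<exists>!s. s \<in> S e \<inter> C))"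


section \<open>Words and the fundamental group\<close>

text \<open>The word \<open>g\<^sub>1 e\<^sub>1 \<dots> g\<^sub>n e\<^sub>n g\<^sub>n\<^sub>+\<^sub>1\<close> is the pair of the list
  \<open>[(g\<^sub>1, e\<^sub>1), \<dots>, (g\<^sub>n, e\<^sub>n)]\<close> and the final group element. A word
  \<open>g\<^sub>1 e\<^sub>1 \<dots> g\<^sub>n e\<^sub>n\<close> without final group element is identified with the one whose final
  group element is 1.\<close>

type_synonym ('e, 'g) gword = "('g \<times> 'e) list \<times> 'g"

definition gwords :: "('v, 'e, 'g, 'h) gog \<Rightarrow> 'v \<Rightarrow> 'v \<Rightarrow> ('e, 'g) gword set" where
  "gwords \<G> x y = {(p, k). is_path \<G> x (map snd p) y \<and>
     (\<forall>(g, e) \<in> set p. g \<in> carrier (vgrp \<G> (rng \<G> e))) \<and> k \<in> carrier (vgrp \<G> y)}"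

definition reduced_gword ::
    "('v, 'e, 'g, 'h) gog \<Rightarrow> ('e \<Rightarrow> 'g set) \<Rightarrow> ('e, 'g) gword \<Rightarrow> bool" where
  "reduced_gword \<G> S = (\<lambda>(p, k).
     (\<forall>(g, e) \<in> set p. g \<in> S e) \<and>
     (\<forall>i. Suc i < length p \<and> snd (p ! i) = bar \<G> (snd (p ! Suc i)) \<longrightarrow>
        fst (p ! Suc i) \<noteq> \<one>\<^bsub>vgrp \<G> (rng \<G> (snd (p ! Suc i)))\<^esub>))"

definition gpaths :: "('v, 'e, 'g, 'h) gog \<Rightarrow> ('e \<Rightarrow> 'g set) \<Rightarrow> 'v \<Rightarrow> ('g \<times> 'e) list set" where
  "gpaths \<G> S x = {p. \<exists>y. (p, \<one>\<^bsub>vgrp \<G> y\<^esub>) \<in> gwords \<G> x y \<and>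
     reduced_gword \<G> S (p, \<one>\<^bsub>vgrp \<G> y\<^esub>)}"

text \<open>Concatenation of two words meeting at the vertex \<open>y\<close>: the final group element of the first
  and the initial group element of the second are multiplied in the vertex group of \<open>y\<close>.\<close>

fun wcat :: "('v, 'e, 'g, 'h) gog \<Rightarrow> 'v \<Rightarrow> ('e, 'g) gword \<Rightarrow> ('e, 'g) gword \<Rightarrow> ('e, 'g) gword"
where
  "wcat \<G> y (p, g) ([], h) = (p, g \<otimes>\<^bsub>vgrp \<G> y\<^esub> h)"
| "wcat \<G> y (p, g) ((a, e) # q, h) = (p @ (g \<otimes>\<^bsub>vgrp \<G> y\<^esub> a, e) # q, h)"

text \<open>The congruence on words generated by \<open>e (bar e) = 1\<close> and
  \<open>e \<alpha>\<^bsub>bar e\<^esub>(h) = \<alpha>\<^bsub>e\<^esub>(h) e\<close>; the relations of the vertex groups are already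
  built into the concatenation.\<close>

inductive weq :: "('v, 'e, 'g, 'h) gog \<Rightarrow> 'v \<Rightarrow> 'v \<Rightarrow> ('e, 'g) gword \<Rightarrow> ('e, 'g) gword \<Rightarrow> bool"
  for \<G> where
  refl: "u \<in> gwords \<G> x y \<Longrightarrow> weq \<G> x y u u"
| sym: "weq \<G> x y u w \<Longrightarrow> weq \<G> x y w u"
| trans: "weq \<G> x y u w \<Longrightarrow> weq \<G> x y w z \<Longrightarrow> weq \<G> x y u z"
| cong: "weq \<G> x y u u' \<Longrightarrow> weq \<G> y z w w' \<Longrightarrow> weq \<G> x z (wcat \<G> y u w) (wcat \<G> y u' w')"
| cancel: "e \<in> edges \<G> \<Longrightarrow> weq \<G> (rng \<G> e) (rng \<G> e)
    ([(\<one>\<^bsub>vgrp \<G> (rng \<G> e)\<^esub>, e), (\<one>\<^bsub>vgrp \<G> (src \<G> e)\<^esub>, bar \<G> e)], \<one>\<^bsub>vgrp \<G> (rng \<G> e)\<^esub>)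
    ([], \<one>\<^bsub>vgrp \<G> (rng \<G> e)\<^esub>)"
| slide: "e \<in> edges \<G> \<Longrightarrow> h \<in> carrier (egrp \<G> e) \<Longrightarrow> weq \<G> (rng \<G> e) (src \<G> e)
    ([(\<one>\<^bsub>vgrp \<G> (rng \<G> e)\<^esub>, e)], emb \<G> (bar \<G> e) h)
    ([(emb \<G> e h, e)], \<one>\<^bsub>vgrp \<G> (src \<G> e)\<^esub>)"

definition loop_rel :: "('v, 'e, 'g, 'h) gog \<Rightarrow> 'v \<Rightarrow> ('e, 'g) gword rel" where
  "loop_rel \<G> v = {(u, w). weq \<G> v v u w}"

definition fund_group :: "('v, 'e, 'g, 'h) gog \<Rightarrow> 'v \<Rightarrow> ('e, 'g) gword set monoid" where
  "fund_group \<G> v =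
     \<lparr>carrier = gwords \<G> v v // loop_rel \<G> v,
      mult = (\<lambda>A B. \<Union>a\<in>A. \<Union>b\<in>B. loop_rel \<G> v `` {wcat \<G> v a b}),
      one = loop_rel \<G> v `` {([], \<one>\<^bsub>vgrp \<G> v\<^esub>)}\<rparr>"


section \<open>The boundary and the action on it\<close>

text \<open>\<open>boundary \<G> S x\<close> is the set of infinite reduced paths \<open>g\<^sub>1 e\<^sub>1 g\<^sub>2 e\<^sub>2 \<dots>\<close> with range \<open>x\<close>,
  where \<open>\<xi> i = (g\<^sub>i\<^sub>+\<^sub>1, e\<^sub>i\<^sub>+\<^sub>1)\<close>.\<close>

definition boundary ::
    "('v, 'e, 'g, 'h) gog \<Rightarrow> ('e \<Rightarrow> 'g set) \<Rightarrow> 'v \<Rightarrow> (nat \<Rightarrow> 'g \<times> 'e) set" where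
  "boundary \<G> S x = {\<xi>. \<forall>n. map \<xi> [0..<n] \<in> gpaths \<G> S x}"

definition cylinder :: "('v, 'e, 'g, 'h) gog \<Rightarrow> ('e \<Rightarrow> 'g set) \<Rightarrow> 'v \<Rightarrow>
    ('g \<times> 'e) list \<Rightarrow> (nat \<Rightarrow> 'g \<times> 'e) set" where
  "cylinder \<G> S x \<mu> = {\<xi> \<in> boundary \<G> S x. map \<xi> [0..<length \<mu>] = \<mu>}"

definition boundary_topology ::
    "('v, 'e, 'g, 'h) gog \<Rightarrow> ('e \<Rightarrow> 'g set) \<Rightarrow> 'v \<Rightarrow> (nat \<Rightarrow> 'g \<times> 'e) topology" where
  "boundary_topology \<G> S x =
     topology (arbitrary union_of (\<lambda>U. \<exists>\<mu> \<in> gpaths \<G> S x. U = cylinder \<G> S x \<mu>))"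

definition lies_on :: "'e \<Rightarrow> (nat \<Rightarrow> 'g \<times> 'e) \<Rightarrow> bool" where
  "lies_on e \<xi> \<longleftrightarrow> (\<exists>i. snd (\<xi> i) = e)"

text \<open>Reduction pushes group elements to the right: \<open>g \<in> G\<^bsub>r(e)\<^esub>\<close> is written as
  \<open>s \<alpha>\<^bsub>e\<^esub>(h)\<close> with \<open>s \<in> S e\<close>, and then \<open>g e = s e \<alpha>\<^bsub>bar e\<^esub>(h)\<close>. Here
  \<open>rep \<G> S e g\<close> is \<open>s\<close> and \<open>push \<G> S e g\<close> is \<open>\<alpha>\<^bsub>bar e\<^esub>(h)\<close>.\<close>

definition rep :: "('v, 'e, 'g, 'h) gog \<Rightarrow> ('e \<Rightarrow> 'g set) \<Rightarrow> 'e \<Rightarrow> 'g \<Rightarrow> 'g" where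
  "rep \<G> S e g =
     (THE s. s \<in> S e \<and> (\<exists>h \<in> carrier (egrp \<G> e). g = s \<otimes>\<^bsub>vgrp \<G> (rng \<G> e)\<^esub> emb \<G> e h))"

definition push :: "('v, 'e, 'g, 'h) gog \<Rightarrow> ('e \<Rightarrow> 'g set) \<Rightarrow> 'e \<Rightarrow> 'g \<Rightarrow> 'g" where
  "push \<G> S e g = emb \<G> (bar \<G> e)
     (THE h. h \<in> carrier (egrp \<G> e) \<and>
        g = rep \<G> S e g \<otimes>\<^bsub>vgrp \<G> (rng \<G> e)\<^esub> emb \<G> e h)"

text \<open>\<open>carry \<G> S g \<xi> n\<close> is the group element that remains to be multiplied onto the entry
  \<open>\<xi> n\<close> when \<open>g\<close> is concatenated with \<open>\<xi>\<close> and the first \<open>n\<close> entries have been reduced.\<close>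

primrec carry :: "('v, 'e, 'g, 'h) gog \<Rightarrow> ('e \<Rightarrow> 'g set) \<Rightarrow> 'g \<Rightarrow>
    (nat \<Rightarrow> 'g \<times> 'e) \<Rightarrow> nat \<Rightarrow> 'g" where
  "carry \<G> S g \<xi> 0 = g"
| "carry \<G> S g \<xi> (Suc n) = push \<G> S (snd (\<xi> n))
     (carry \<G> S g \<xi> n \<otimes>\<^bsub>vgrp \<G> (rng \<G> (snd (\<xi> n)))\<^esub> fst (\<xi> n))"

text \<open>Concatenation followed by reduction, for a single group element, a single edge and a
  word.\<close>

definition act_elt :: "('v, 'e, 'g, 'h) gog \<Rightarrow> ('e \<Rightarrow> 'g set) \<Rightarrow> 'g \<Rightarrow>
    (nat \<Rightarrow> 'g \<times> 'e) \<Rightarrow> nat \<Rightarrow> 'g \<times> 'e" where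
  "act_elt \<G> S g \<xi> = (\<lambda>n. (rep \<G> S (snd (\<xi> n))
     (carry \<G> S g \<xi> n \<otimes>\<^bsub>vgrp \<G> (rng \<G> (snd (\<xi> n)))\<^esub> fst (\<xi> n)), snd (\<xi> n)))"

definition act_edge :: "('v, 'e, 'g, 'h) gog \<Rightarrow> 'e \<Rightarrow>
    (nat \<Rightarrow> 'g \<times> 'e) \<Rightarrow> nat \<Rightarrow> 'g \<times> 'e" where
  "act_edge \<G> e \<xi> =
     (if \<xi> 0 = (\<one>\<^bsub>vgrp \<G> (src \<G> e)\<^esub>, bar \<G> e) then (\<lambda>n. \<xi> (Suc n))
      else case_nat (\<one>\<^bsub>vgrp \<G> (rng \<G> e)\<^esub>, e) \<xi>)"

fun act_word :: "('v, 'e, 'g, 'h) gog \<Rightarrow> ('e \<Rightarrow> 'g set) \<Rightarrow> ('e, 'g) gword \<Rightarrow>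
    (nat \<Rightarrow> 'g \<times> 'e) \<Rightarrow> nat \<Rightarrow> 'g \<times> 'e" where
  "act_word \<G> S ([], k) \<xi> = act_elt \<G> S k \<xi>"
| "act_word \<G> S ((g, e) # p, k) \<xi> = act_elt \<G> S g (act_edge \<G> e (act_word \<G> S (p, k) \<xi>))"

text \<open>The action of a class of words is that of any of its members.\<close>

definition fund_act :: "('v, 'e, 'g, 'h) gog \<Rightarrow> ('e \<Rightarrow> 'g set) \<Rightarrow> ('e, 'g) gword set \<Rightarrow>
    (nat \<Rightarrow> 'g \<times> 'e) \<Rightarrow> nat \<Rightarrow> 'g \<times> 'e" where
  "fund_act \<G> S \<gamma> \<xi> = the_elem ((\<lambda>w. act_word \<G> S w \<xi>) ` \<gamma>)"

definition minimal_action ::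
    "('a, 'b) monoid_scheme \<Rightarrow> 'x topology \<Rightarrow> ('a \<Rightarrow> 'x \<Rightarrow> 'x) \<Rightarrow> bool" where
  "minimal_action G X \<phi> \<longleftrightarrow> (\<forall>\<xi> \<in> topspace X. X closure_of (orbit G \<phi> \<xi>) = topspace X)"


section \<open>Treelike edges\<close>

text \<open>\<open>branch \<G> e\<close> is the subgraph \<open>E\<^bsub>s,e\<^esub>\<close>.\<close>

definition branch_paths :: "('v, 'e, 'z) sgraph_scheme \<Rightarrow> 'e \<Rightarrow> 'v \<Rightarrow> 'e list set" where
  "branch_paths \<Gamma> e x = {es \<in> rpaths \<Gamma> (src \<Gamma> e) x. es \<noteq> [] \<and>
     (if src \<Gamma> e \<noteq> rng \<Gamma> e then hd es \<noteq> bar \<Gamma> e else hd es \<notin> {e, bar \<Gamma> e})}"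

definition branch :: "('v, 'e, 'z) sgraph_scheme \<Rightarrow> 'e \<Rightarrow> ('v, 'e) sgraph" where
  "branch \<Gamma> e =
     (let E = (\<Union>x. \<Union>es \<in> branch_paths \<Gamma> e x. set es) in
      \<lparr>verts = insert (src \<Gamma> e) {x. branch_paths \<Gamma> e x \<noteq> {}},
       edges = E \<union> bar \<Gamma> ` E,
       rng = rng \<Gamma>, src = src \<Gamma>, bar = bar \<Gamma>\<rparr>)"

definition treelike :: "('v, 'e, 'g, 'h) gog \<Rightarrow> 'e \<Rightarrow> bool" where
  "treelike \<G> e \<longleftrightarrow> is_tree (branch \<G> e) \<and>
     (\<forall>f \<in> edges (branch \<G> e).
        points_towards (branch \<G> e) f (src \<G> e) \<longrightarrow> emb_onto \<G> (bar \<G> f))"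

end

theory Submission
  imports Defs
begin

text \<open>A tail of the edge sequence is invariant under the action, so the orbit of \<open>\<xi>\<close> misses a
  cylinder exactly when some set of edges is a trap avoided by \<open>\<xi>\<close>: an infinite reduced path that
  enters the trap never leaves it. Call \<open>N\<close> the set of edges that lie on no point of the orbit of
  \<open>\<xi>\<close> under the fundamental groupoid. If \<open>f \<in> N\<close>, then every orbit point \<open>\<eta>\<close> with range \<open>s(f)\<close>
  starts with \<open>1 \<cdot> bar f\<close>, since otherwise \<open>f \<eta>\<close> would be a reduced orbit point through \<open>f\<close>. Hence
  \<open>\<alpha>\<^bsub>bar f\<^esub>\<close> is onto, every edge other than \<open>bar f\<close> with range \<open>s(f)\<close> is in \<open>N\<close>, and \<open>f\<close> is the
  only edge of \<open>N\<close> with source \<open>s(f)\<close>. So paths in \<open>N\<close> can be traced backwards in a unique way. If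
  some \<open>e \<in> N\<close> does not lie on a closed path in \<open>N\<close>, the branch behind \<open>e\<close> is a tree with all
  edges oriented away from \<open>e\<close>, which is (c'); otherwise \<open>N\<close> is a single cycle that exhausts
  \<open>\<Gamma>\<close>, which is (d). Conversely, the edges of the branch together with \<open>e\<close>, or the edges of the cycle,
  form a trap that is avoided by some point.\<close>

section \<open>Paths and minimal cycles\<close>

lemma reduced_successively: "reduced \<Gamma> es \<longleftrightarrow> successively (\<lambda>e f. f \<noteq> bar \<Gamma> e) es"
  by (simp add: reduced_def successively_conv_nth)

lemma reduced_Nil [simp]: "reduced \<Gamma> []"
  by (simp add: reduced_successively)

lemma reduced_Cons:
  "reduced \<Gamma> (e # es) \<longleftrightarrow> es = [] \<or> hd es \<noteq> bar \<Gamma> e \<and> reduced \<Gamma> es"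
  by (simp add: reduced_successively successively_Cons)

lemma reduced_append:
  "reduced \<Gamma> (p @ q) \<longleftrightarrow> reduced \<Gamma> p \<and> reduced \<Gamma> q \<and>
     (p = [] \<or> q = [] \<or> hd q \<noteq> bar \<Gamma> (last p))"
  by (auto simp: reduced_successively successively_append_iff)

lemma is_path_edges: "is_path \<Gamma> x es y \<Longrightarrow> set es \<subseteq> edges \<Gamma>"
  by (induction es arbitrary: x) auto

lemma is_path_hd: "is_path \<Gamma> x es y \<Longrightarrow> es \<noteq> [] \<Longrightarrow> rng \<Gamma> (hd es) = x"
  by (cases es) auto

lemma is_path_last: "is_path \<Gamma> x es y \<Longrightarrow> es \<noteq> [] \<Longrightarrow> src \<Gamma> (last es) = y"
  by (induction es arbitrary: x) (auto split: if_splits)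

context sgraph
begin

lemma is_path_target: "is_path \<Gamma> x es y \<Longrightarrow> y \<in> verts \<Gamma>"
  by (induction es arbitrary: x) auto

lemma is_path_start: "is_path \<Gamma> x es y \<Longrightarrow> x \<in> verts \<Gamma>"
  by (cases es) (auto simp: rng_in)

lemma is_path_append:
  "is_path \<Gamma> x (p @ q) y \<longleftrightarrow> (\<exists>z. is_path \<Gamma> x p z \<and> is_path \<Gamma> z q y)"
proof (induction p arbitrary: x)
  case Nil
  then show ?case using is_path_start by auto
qed auto

lemma is_path_snoc:
  "is_path \<Gamma> x (p @ [e]) y \<longleftrightarrow> is_path \<Gamma> x p (rng \<Gamma> e) \<and> e \<in> edges \<Gamma> \<and> y = src \<Gamma> e"
  by (auto simp: is_path_append src_in)

lemma rng_bar: "e \<in> edges \<Gamma> \<Longrightarrow> rng \<Gamma> (bar \<Gamma> e) = src \<Gamma> e"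
  by (simp add: src_eq)

lemma src_bar: "e \<in> edges \<Gamma> \<Longrightarrow> src \<Gamma> (bar \<Gamma> e) = rng \<Gamma> e"
  by (simp add: src_eq bar_in bar_bar)

lemma is_path_rev: "is_path \<Gamma> x es y \<Longrightarrow> is_path \<Gamma> y (rev (map (bar \<Gamma>) es)) x"
  by (induction es arbitrary: x)
    (auto simp: is_path_snoc rng_bar src_bar bar_in intro: is_path_target)

text \<open>A backtracking \<open>e\<close>, \<open>bar \<Gamma> e\<close> comes back to r(e), which
  then reappears either as the range of the next edge or as the end of the path. The second
  possibility is why \<open>y\<close> is included among the distinct vertices.\<close>

lemma distinct_verts_reduced:
  "is_path \<Gamma> x es y \<Longrightarrow> distinct (map (rng \<Gamma>) es @ [y]) \<Longrightarrow> reduced \<Gamma> es"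
proof (induction es arbitrary: x)
  case (Cons e es)
  have "hd es \<noteq> bar \<Gamma> e" if nonempty: "es \<noteq> []"
  proof
    assume eq: "hd es = bar \<Gamma> e"
    obtain f fs where es: "es = f # fs" using nonempty by (cases es) auto
    have "src \<Gamma> f = rng \<Gamma> e" using eq es Cons.prems src_bar by auto
    moreover have "is_path \<Gamma> (src \<Gamma> f) fs y" using Cons.prems es by auto
    then have "src \<Gamma> f \<in> set (map (rng \<Gamma>) fs @ [y])" by (cases fs) auto
    ultimately show False using Cons.prems(2) es by auto
  qed
  moreover have "reduced \<Gamma> es" using Cons by auto
  ultimately show ?case by (auto simp: reduced_Cons)
qed auto

text \<open>Loop erasure by induction: \<open>e\<close> is put in front of a simple path
  \<open>p\<close> from s(e), and if \<open>x\<close> already occurs on \<open>p\<close>, everything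
  before that occurrence is dropped. Tracking the allowed edges \<open>A\<close> lets later
  arguments keep a cycle inside a given set or off a given edge.\<close>

lemma simple_path:
  assumes "is_path \<Gamma> x es y" "set es \<subseteq> A"
  obtains es' where "is_path \<Gamma> x es' y" "set es' \<subseteq> A" "distinct (map (rng \<Gamma>) es' @ [y])"
proof -
  have "\<exists>es'. is_path \<Gamma> x es' y \<and> set es' \<subseteq> A \<and> distinct (map (rng \<Gamma>) es' @ [y])"
    using assms
  proof (induction es arbitrary: x)
    case Nil
    then show ?case by (intro exI[of _ "[]"]) auto
  next
    case (Cons e es)
    then have "\<exists>p. is_path \<Gamma> (src \<Gamma> e) p y \<and> set p \<subseteq> A \<and> distinct (map (rng \<Gamma>) p @ [y])"
      by (intro Cons.IH) auto
    then obtain p where p: "is_path \<Gamma> (src \<Gamma> e) p y" "set p \<subseteq> A"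
      "distinct (map (rng \<Gamma>) p @ [y])" by blast
    have e: "e \<in> edges \<Gamma>" "rng \<Gamma> e = x" "e \<in> A" using Cons.prems by auto
    consider "x = y" | "x \<noteq> y" "x \<in> rng \<Gamma> ` set p" | "x \<notin> insert y (rng \<Gamma> ` set p)" by auto
    then show ?case
    proof cases
      case 1
      then show ?thesis using is_path_target[OF p(1)] by (intro exI[of _ "[]"]) auto
    next
      case 2
      then obtain f where f: "f \<in> set p" "rng \<Gamma> f = x" by auto
      then obtain a b where ab: "p = a @ f # b" by (meson split_list)
      have "is_path \<Gamma> x (f # b) y" using p(1) f(2) unfolding ab is_path_append by auto
      then show ?thesis using p ab by (intro exI[of _ "f # b"]) auto
    next
      case 3
      then show ?thesis using p e by (intro exI[of _ "e # p"]) auto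
    qed
  qed
  then show thesis using that by blast
qed

text \<open>If the first edge \<open>h\<close> were the reversal of the last edge, the second edge
  would have the same range as the last one and hence be the last one, because ranges are distinct.
  It would then also be the reversal of \<open>h\<close>, against reducedness. On a cycle of length
  1, \<open>h\<close> would be its own reversal.\<close>

lemma minimal_cycle_wrap:
  assumes "minimal_cycle \<Gamma> c"
  shows "hd c \<noteq> bar \<Gamma> (last c)"
proof
  assume eq: "hd c = bar \<Gamma> (last c)"
  obtain x where c: "c \<noteq> []" "is_path \<Gamma> x c x" "reduced \<Gamma> c" "distinct (map (rng \<Gamma>) c)"
    using assms by (auto simp: minimal_cycle_def rpaths_def)
  have ed: "set c \<subseteq> edges \<Gamma>" using is_path_edges c(2) .
  obtain h t where ht: "c = h # t" using c(1) by (cases c) auto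
  show False
  proof (cases t)
    case Nil
    then show False using eq ht ed bar_neq[of h] by auto
  next
    case (Cons g u)
    have l: "last c \<in> set (g # u)" "last c \<in> edges \<Gamma>" using ht Cons ed by auto
    have "rng \<Gamma> g = src \<Gamma> h" using c(2) ht Cons by auto
    also have "\<dots> = rng \<Gamma> (last c)" using eq ht src_bar[OF l(2)] by simp
    finally have gl: "g = last c" using c(4) ht Cons l
      by (auto simp: distinct_map inj_on_def)
    then show False using eq c(3) ht Cons l(2) bar_bar by (auto simp: reduced_Cons)
  qed
qed

lemma minimal_cycle_rotate:
  assumes "minimal_cycle \<Gamma> (a @ b)"
  shows "minimal_cycle \<Gamma> (b @ a)"
proof -
  obtain x where c: "is_path \<Gamma> x (a @ b) x" "reduced \<Gamma> (a @ b)" "distinct (map (rng \<Gamma>) (a @ b))"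
    using assms by (auto simp: minimal_cycle_def rpaths_def)
  obtain z where "is_path \<Gamma> x a z" "is_path \<Gamma> z b x" using c(1) is_path_append by auto
  then have "is_path \<Gamma> z (b @ a) z" using is_path_append by blast
  moreover have "reduced \<Gamma> (b @ a)"
    using c(2) minimal_cycle_wrap[OF assms] by (auto simp: reduced_append)
  ultimately show ?thesis using assms c(3)
    by (auto simp: minimal_cycle_def rpaths_def)
qed

lemma minimal_cycle_hd:
  assumes "minimal_cycle \<Gamma> c" "e \<in> set c"
  obtains b where "minimal_cycle \<Gamma> (e # b)" "set (e # b) = set c"
    "is_path \<Gamma> (src \<Gamma> e) b (rng \<Gamma> e)" "e \<in> edges \<Gamma>"
proof -
  obtain p q where c: "c = p @ e # q" using assms(2) by (meson split_list)
  have m: "minimal_cycle \<Gamma> (e # (q @ p))"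
    using minimal_cycle_rotate[of p "e # q"] assms(1) c by auto
  then have "is_path \<Gamma> (src \<Gamma> e) (q @ p) (rng \<Gamma> e)" "e \<in> edges \<Gamma>"
    by (auto simp: minimal_cycle_def rpaths_def)
  then show thesis using that[OF m] c by auto
qed

text \<open>After a rotation \<open>e\<close> comes first. The reversal of \<open>e\<close> has the
  same range as the second edge, so it could only be the second edge, which reducedness
  forbids.\<close>

lemma minimal_cycle_bar:
  assumes "minimal_cycle \<Gamma> c" "e \<in> set c"
  shows "bar \<Gamma> e \<notin> set c"
proof
  assume bc: "bar \<Gamma> e \<in> set c"
  obtain b where b: "minimal_cycle \<Gamma> (e # b)" "set (e # b) = set c"
    "is_path \<Gamma> (src \<Gamma> e) b (rng \<Gamma> e)" "e \<in> edges \<Gamma>"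
    using minimal_cycle_hd assms by blast
  then have bb: "bar \<Gamma> e \<in> set b" using bc bar_neq by auto
  then obtain h t where ht: "b = h # t" by (cases b) auto
  have "rng \<Gamma> h = rng \<Gamma> (bar \<Gamma> e)" using b(3,4) ht rng_bar by auto
  then have "h = bar \<Gamma> e" using b(1) bb ht
    by (auto simp: minimal_cycle_def distinct_map inj_on_def)
  then show False using b(1) ht by (auto simp: minimal_cycle_def rpaths_def reduced_Cons)
qed

text \<open>The source of an edge is the range of the edge that follows it cyclically. Cutting the
  cycle after \<open>f\<close> and after \<open>e\<close> gives two pieces with disjoint sets of
  ranges; equal sources would make their first edges share a range.\<close>

lemma minimal_cycle_inj_src:
  assumes c: "minimal_cycle \<Gamma> c"
  shows "inj_on (src \<Gamma>) (set c)"
proof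
  fix e f assume ef: "e \<in> set c" "f \<in> set c" "src \<Gamma> e = src \<Gamma> f"
  obtain b where b: "minimal_cycle \<Gamma> (e # b)" "set (e # b) = set c"
    "is_path \<Gamma> (src \<Gamma> e) b (rng \<Gamma> e)" "e \<in> edges \<Gamma>"
    using minimal_cycle_hd[OF c ef(1)] by blast
  show "e = f"
  proof (rule ccontr)
    assume "e \<noteq> f"
    then obtain p q where pq: "b = p @ f # q" using ef(2) b(2) split_list by fastforce
    have "is_path \<Gamma> (src \<Gamma> e) (p @ [f]) (src \<Gamma> f)"
      using b(3) unfolding pq is_path_append by (auto intro: is_path_start)
    then have 1: "rng \<Gamma> (hd (p @ [f])) = src \<Gamma> e" by (rule is_path_hd) auto
    have "is_path \<Gamma> (src \<Gamma> f) (q @ [e]) (src \<Gamma> e)"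
      using b(3,4) unfolding pq is_path_append by (auto simp: src_in)
    then have 2: "rng \<Gamma> (hd (q @ [e])) = src \<Gamma> f" by (rule is_path_hd) auto
    have "hd (p @ [f]) \<in> set (p @ [f])" "hd (q @ [e]) \<in> set (q @ [e])" by (simp_all del: set_append)
    moreover have "rng \<Gamma> ` set (p @ [f]) \<inter> rng \<Gamma> ` set (q @ [e]) = {}"
      using b(1) pq by (auto simp: minimal_cycle_def)
    ultimately show False using 1 2 ef(3) by (metis IntI empty_iff imageI)
  qed
qed

lemma minimal_cycle_pred:
  assumes "minimal_cycle \<Gamma> c" "e \<in> set c"
  obtains f where "f \<in> set c" "src \<Gamma> f = rng \<Gamma> e"
proof -
  obtain b where b: "minimal_cycle \<Gamma> (e # b)" "set (e # b) = set c"
    "is_path \<Gamma> (src \<Gamma> e) b (rng \<Gamma> e)" "e \<in> edges \<Gamma>"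
    using minimal_cycle_hd assms by blast
  then have "src \<Gamma> (last (e # b)) = rng \<Gamma> e"
    using is_path_last[of \<Gamma> "rng \<Gamma> e" "e # b"] by auto
  moreover have "last (e # b) \<in> set c" using b(2) last_in_set by blast
  ultimately show thesis using that by blast
qed

text \<open>After loop erasure the return path \<open>q\<close> is reduced and does not meet r(e)
  before its end. Prefixing \<open>e\<close> can create a backtracking only at the first junction,
  which is excluded because \<open>p\<close> avoids the reversal of \<open>e\<close>.\<close>

lemma minimal_cycle_of_detour:
  assumes e: "e \<in> edges \<Gamma>" and p: "is_path \<Gamma> (src \<Gamma> e) p (rng \<Gamma> e)" "bar \<Gamma> e \<notin> set p"
  shows "\<exists>c. minimal_cycle \<Gamma> c \<and> e \<in> set c \<and> set c \<subseteq> insert e (set p)"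
proof -
  obtain q where q: "is_path \<Gamma> (src \<Gamma> e) q (rng \<Gamma> e)" "set q \<subseteq> set p"
    "distinct (map (rng \<Gamma>) q @ [rng \<Gamma> e])"
    using simple_path[OF p(1), of "set p"] by auto
  have "reduced \<Gamma> q" using distinct_verts_reduced q by blast
  moreover have "hd q \<noteq> bar \<Gamma> e" if "q \<noteq> []" using that q(2) p(2) hd_in_set by fastforce
  ultimately have "reduced \<Gamma> (e # q)" by (auto simp: reduced_Cons)
  then have "minimal_cycle \<Gamma> (e # q)" using q e
    by (auto simp: minimal_cycle_def rpaths_def)
  then show ?thesis using q(2) by (intro exI[of _ "e # q"]) auto
qed

subsection \<open>Branches\<close>

lemma branch_simps [simp]:
  "rng (branch \<Gamma> e) = rng \<Gamma>" "src (branch \<Gamma> e) = src \<Gamma>" "bar (branch \<Gamma> e) = bar \<Gamma>"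
  "verts (branch \<Gamma> e) = insert (src \<Gamma> e) {x. branch_paths \<Gamma> e x \<noteq> {}}"
  by (auto simp: branch_def Let_def)

lemma reduced_branch [simp]: "reduced (branch \<Gamma> e) = reduced \<Gamma>"
  by (auto simp: reduced_def fun_eq_iff)

text \<open>Records the direction in which paths out of s(e) traverse the branch.
  \<open>branch\<close> itself also contains the reversals, whereas a trap must be oriented.\<close>

definition branch_edges :: "'e \<Rightarrow> 'e set" where
  "branch_edges e = (\<Union>x. \<Union>es \<in> branch_paths \<Gamma> e x. set es)"

lemma edges_branch: "edges (branch \<Gamma> e) = branch_edges e \<union> bar \<Gamma> ` branch_edges e"
  by (simp add: branch_def branch_edges_def Let_def)

lemma branch_paths_subpath:
  assumes "p @ q \<in> branch_paths \<Gamma> e x" "p \<noteq> []"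
  obtains y where "p \<in> branch_paths \<Gamma> e y" "is_path \<Gamma> y q x"
  using assms by (force simp: branch_paths_def rpaths_def is_path_append reduced_append)

lemma branch_edgesE:
  assumes "f \<in> branch_edges e"
  obtains p where "p @ [f] \<in> branch_paths \<Gamma> e (src \<Gamma> f)"
proof -
  obtain x es where es: "es \<in> branch_paths \<Gamma> e x" "f \<in> set es"
    using assms by (auto simp: branch_edges_def)
  then obtain p q where pq: "es = (p @ [f]) @ q" by (metis append.assoc append_Cons append_Nil split_list)
  then obtain y where y: "p @ [f] \<in> branch_paths \<Gamma> e y" using branch_paths_subpath es(1) by blast
  then have "y = src \<Gamma> f" by (auto simp: branch_paths_def rpaths_def is_path_append)
  then show thesis using that y by blast
qed

lemma branch_edges_subset: "branch_edges e \<subseteq> edges \<Gamma>"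
  using is_path_edges by (fastforce simp: branch_edges_def branch_paths_def rpaths_def)

lemma branch_src_in: "f \<in> branch_edges e \<Longrightarrow> src \<Gamma> f \<in> verts (branch \<Gamma> e)"
  by (auto elim: branch_edgesE)

lemma branch_rng_in:
  assumes "f \<in> branch_edges e"
  shows "rng \<Gamma> f \<in> verts (branch \<Gamma> e)"
proof -
  obtain p where p: "p @ [f] \<in> branch_paths \<Gamma> e (src \<Gamma> f)" using branch_edgesE assms .
  show ?thesis
  proof (cases "p = []")
    case True
    then show ?thesis using p by (auto simp: branch_paths_def rpaths_def)
  next
    case False
    then obtain y where "p \<in> branch_paths \<Gamma> e y" "is_path \<Gamma> y [f] (src \<Gamma> f)"
      using branch_paths_subpath p by blast
    then show ?thesis by auto
  qed
qed

lemma verts_branch_subset: "e \<in> edges \<Gamma> \<Longrightarrow> verts (branch \<Gamma> e) \<subseteq> verts \<Gamma>"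
  by (auto simp: src_in branch_paths_def rpaths_def dest: is_path_target)

lemma edges_branch_subset: "edges (branch \<Gamma> e) \<subseteq> edges \<Gamma>"
  using branch_edges_subset[of e] by (auto simp: edges_branch bar_in)

lemma sgraph_branch:
  assumes "e \<in> edges \<Gamma>"
  shows "sgraph (branch \<Gamma> e)"
proof
  show "countable (verts (branch \<Gamma> e))"
    using verts_branch_subset[OF assms] countable_verts countable_subset by blast
  show "countable (edges (branch \<Gamma> e))"
    using edges_branch_subset countable_edges countable_subset by blast
next
  fix f assume f: "f \<in> edges (branch \<Gamma> e)"
  then have fe: "f \<in> edges \<Gamma>" using edges_branch_subset by blast
  have E: "g \<in> edges \<Gamma>" if "g \<in> branch_edges e" for g using that branch_edges_subset by blast
  show "rng (branch \<Gamma> e) f \<in> verts (branch \<Gamma> e)" "src (branch \<Gamma> e) f \<in> verts (branch \<Gamma> e)"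
    using f E branch_src_in branch_rng_in
    by (auto simp: edges_branch rng_bar src_bar simp del: branch_simps(4))
  show "bar (branch \<Gamma> e) f \<in> edges (branch \<Gamma> e)"
    using f E by (auto simp: edges_branch bar_bar)
  show "bar (branch \<Gamma> e) f \<noteq> f" "bar (branch \<Gamma> e) (bar (branch \<Gamma> e) f) = f"
    "src (branch \<Gamma> e) f = rng (branch \<Gamma> e) (bar (branch \<Gamma> e) f)"
    using fe by (auto simp: bar_neq bar_bar src_eq)
qed

lemma is_path_branch:
  assumes e: "e \<in> edges \<Gamma>"
  shows "is_path (branch \<Gamma> e) x es y \<longleftrightarrow> is_path \<Gamma> x es y \<and>
    set es \<subseteq> edges (branch \<Gamma> e) \<and> (es = [] \<longrightarrow> x \<in> verts (branch \<Gamma> e))"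
proof (induction es arbitrary: x)
  case Nil
  then show ?case using verts_branch_subset[OF e] by auto
next
  case (Cons f es)
  have "src \<Gamma> f \<in> verts (branch \<Gamma> e)" if "f \<in> edges (branch \<Gamma> e)"
    using sgraph.src_in[OF sgraph_branch[OF e] that] by simp
  then show ?case using Cons edges_branch_subset by (auto simp del: branch_simps(4))
qed

lemma branch_paths_rpaths:
  assumes "e \<in> edges \<Gamma>" "p \<in> branch_paths \<Gamma> e x"
  shows "p \<in> rpaths (branch \<Gamma> e) (src \<Gamma> e) x"
proof -
  have "set p \<subseteq> branch_edges e" using assms by (auto simp: branch_edges_def)
  then show ?thesis using assms
    by (auto simp: rpaths_def is_path_branch edges_branch branch_paths_def)
qed

lemma Nil_rpaths_branch: "e \<in> edges \<Gamma> \<Longrightarrow> [] \<in> rpaths (branch \<Gamma> e) (src \<Gamma> e) (src \<Gamma> e)"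
  by (auto simp: rpaths_def)

text \<open>If \<open>f\<close> is in the branch, a branch path ending in \<open>f\<close> is
  prolonged by \<open>f'\<close> and keeps its first edge. If \<open>f\<close> is \<open>e\<close>,
  the single edge \<open>f'\<close> is a branch path; as \<open>e\<close> is no loop, only the
  reversal of \<open>e\<close> is forbidden at the start.\<close>

lemma branch_forward:
  assumes "e \<in> edges \<Gamma>" "src \<Gamma> e \<noteq> rng \<Gamma> e" "f \<in> insert e (branch_edges e)"
    "f' \<in> edges \<Gamma>" "rng \<Gamma> f' = src \<Gamma> f" "f' \<noteq> bar \<Gamma> f"
  shows "f' \<in> branch_edges e"
proof -
  have "\<exists>p. p @ [f'] \<in> branch_paths \<Gamma> e (src \<Gamma> f')"
  proof (cases "f \<in> branch_edges e")
    case True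
    then obtain p where "p @ [f] \<in> branch_paths \<Gamma> e (src \<Gamma> f)" using branch_edgesE by blast
    moreover have "hd ((p @ [f]) @ [f']) = hd (p @ [f])" by (cases p) auto
    ultimately have "(p @ [f]) @ [f'] \<in> branch_paths \<Gamma> e (src \<Gamma> f')" using assms
      by (simp add: branch_paths_def rpaths_def is_path_snoc reduced_append reduced_Cons del: append_assoc)
    then show ?thesis by blast
  next
    case False
    then have "[] @ [f'] \<in> branch_paths \<Gamma> e (src \<Gamma> f')" using assms
      by (auto simp: branch_paths_def rpaths_def reduced_Cons src_in)
    then show ?thesis by blast
  qed
  then show ?thesis by (force simp: branch_edges_def)
qed

text \<open>A branch path ending in \<open>f\<close> gives, without \<open>f\<close>, the unique
  reduced path \<open>p\<close> from s(e) to r(f). If \<open>p\<close> contained \<open>f\<close> or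
  its reversal, cutting it before \<open>f\<close> or after the reversal would again give a reduced
  path to r(f). Uniqueness makes this path equal to \<open>p\<close>; in the first case it is too
  short, in the second \<open>p\<close> followed by \<open>f\<close> backtracks.\<close>

lemma points_towards_branch:
  assumes e: "e \<in> edges \<Gamma>" and tree: "is_tree (branch \<Gamma> e)" and f: "f \<in> branch_edges e"
  shows "points_towards (branch \<Gamma> e) f (src \<Gamma> e)"
proof -
  interpret B: sgraph "branch \<Gamma> e" using sgraph_branch e .
  have fe: "f \<in> edges \<Gamma>" using f branch_edges_subset by blast
  have uniq: "p = q" if "p \<in> rpaths (branch \<Gamma> e) (src \<Gamma> e) y" "q \<in> rpaths (branch \<Gamma> e) (src \<Gamma> e) y"
    for p q y
    using tree that B.is_path_start B.is_path_target unfolding is_tree_def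
    by (metis (mono_tags, lifting) mem_Collect_eq rpaths_def)
  obtain p where p: "p @ [f] \<in> branch_paths \<Gamma> e (src \<Gamma> f)" using branch_edgesE f .
  then have pf: "p @ [f] \<in> rpaths (branch \<Gamma> e) (src \<Gamma> e) (src \<Gamma> f)" using branch_paths_rpaths e by blast
  then have pr: "p \<in> rpaths (branch \<Gamma> e) (src \<Gamma> e) (rng \<Gamma> f)"
    by (auto simp: rpaths_def B.is_path_snoc reduced_append)
  have "f \<notin> set p"
  proof
    assume "f \<in> set p"
    then obtain a b where ab: "p = a @ f # b" by (meson split_list)
    then have "a \<in> rpaths (branch \<Gamma> e) (src \<Gamma> e) (rng \<Gamma> f)"
      using pr by (auto simp: rpaths_def B.is_path_append reduced_append)
    then have "a = p" using uniq pr by blast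
    then show False using ab by simp
  qed
  moreover have "bar \<Gamma> f \<notin> set p"
  proof
    assume "bar \<Gamma> f \<in> set p"
    then obtain a b where ab: "p = (a @ [bar \<Gamma> f]) @ b"
      by (metis append.assoc append_Cons append_Nil split_list)
    then have "a @ [bar \<Gamma> f] \<in> rpaths (branch \<Gamma> e) (src \<Gamma> e) (src \<Gamma> (bar \<Gamma> f))"
      using pr unfolding ab
      by (auto simp: rpaths_def B.is_path_append[of _ "a @ [bar \<Gamma> f]"] B.is_path_snoc
          reduced_append[of _ "a @ [bar \<Gamma> f]"] simp del: append_assoc append.simps)
    then have "p = a @ [bar \<Gamma> f]" using uniq pr fe src_bar by metis
    then have "f \<noteq> bar \<Gamma> (bar \<Gamma> f)" using pf by (auto simp: rpaths_def reduced_append reduced_Cons)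
    then show False using fe bar_bar by simp
  qed
  ultimately show ?thesis using uniq pr by (auto simp: points_towards_def)
qed

text \<open>This keeps a point that starts at r(e) and avoids \<open>e\<close> away from the whole
  branch. If \<open>p\<close> met a branch edge \<open>f\<close>, a branch path from s(e) to r(f)
  followed by the reversal of an initial part of \<open>p\<close> would lead to r(e), and so give a
  minimal cycle through \<open>e\<close>.\<close>

lemma path_avoids_branch:
  assumes e: "e \<in> edges \<Gamma>" and tree: "is_tree (branch \<Gamma> e)"
    and nc: "\<And>c. minimal_cycle \<Gamma> c \<Longrightarrow> e \<notin> set c"
    and p: "is_path \<Gamma> (rng \<Gamma> e) p y" "e \<notin> set p"
  shows "set p \<inter> branch_edges e = {}"
proof (rule ccontr)
  assume "set p \<inter> branch_edges e \<noteq> {}"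
  then obtain f where f: "f \<in> set p" "f \<in> branch_edges e" by blast
  obtain a b where ab: "p = a @ f # b" using f by (meson split_list)
  have a: "is_path \<Gamma> (rng \<Gamma> e) a (rng \<Gamma> f)" using p(1) unfolding ab is_path_append by auto
  obtain q where q: "q @ [f] \<in> branch_paths \<Gamma> e (src \<Gamma> f)" using branch_edgesE f(2) .
  then have q': "is_path \<Gamma> (src \<Gamma> e) q (rng \<Gamma> f)"
    by (auto simp: branch_paths_def rpaths_def is_path_snoc)
  show False
  proof (cases "bar \<Gamma> e \<in> set q")
    \<comment> \<open>The detour is unusable if it runs through the reversal of \<open>e\<close>.
      But then its part before that edge is a nonempty reduced closed path at s(e), which a tree
      does not have.\<close>
    case True
    then obtain c d where cd: "q = c @ bar \<Gamma> e # d" by (meson split_list)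
    have "c \<noteq> []" using q cd by (auto simp: branch_paths_def split: if_splits)
    have "c @ (bar \<Gamma> e # d @ [f]) \<in> branch_paths \<Gamma> e (src \<Gamma> f)" using q cd by simp
    then obtain z where z: "c \<in> branch_paths \<Gamma> e z" "is_path \<Gamma> z (bar \<Gamma> e # d @ [f]) (src \<Gamma> f)"
      using branch_paths_subpath \<open>c \<noteq> []\<close> by blast
    then have "z = src \<Gamma> e" using e rng_bar by auto
    then have "c \<in> rpaths (branch \<Gamma> e) (src \<Gamma> e) (src \<Gamma> e)" using branch_paths_rpaths e z by blast
    then show False using tree Nil_rpaths_branch[OF e] \<open>c \<noteq> []\<close>
      unfolding is_tree_def by auto
  next
    case False
    have "is_path \<Gamma> (src \<Gamma> e) (q @ rev (map (bar \<Gamma>) a)) (rng \<Gamma> e)"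
      using q' is_path_rev[OF a] is_path_append by blast
    moreover have "bar \<Gamma> e \<notin> bar \<Gamma> ` set a"
    proof
      assume "bar \<Gamma> e \<in> bar \<Gamma> ` set a"
      then obtain g where g: "g \<in> set a" "bar \<Gamma> e = bar \<Gamma> g" by auto
      then have "g \<in> edges \<Gamma>" using is_path_edges[OF a] by blast
      then have "g = e" using g e bar_bar by metis
      then show False using g p(2) ab by auto
    qed
    ultimately show False using minimal_cycle_of_detour[OF e] nc False by fastforce
  qed
qed

end

section \<open>Forward-closed sets of edges\<close>

text \<open>Collects the graph-theoretic properties of the set of avoided edges.
  \<open>N_closed\<close> traps reduced paths, and \<open>N_inj\<close> leaves at most one way to
  trace a path in \<open>N\<close> backwards from a vertex.\<close>

locale forward_flow = sgraph \<Gamma> for \<Gamma> :: "('v, 'e, 'z) sgraph_scheme" +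
  fixes N :: "'e set"
  assumes N_edges: "N \<subseteq> edges \<Gamma>"
    and N_closed: "f \<in> N \<Longrightarrow> f' \<in> edges \<Gamma> \<Longrightarrow> rng \<Gamma> f' = src \<Gamma> f \<Longrightarrow> f' \<noteq> bar \<Gamma> f \<Longrightarrow> f' \<in> N"
    and N_inj: "inj_on (src \<Gamma>) N"
    and N_bar: "f \<in> N \<Longrightarrow> bar \<Gamma> f \<notin> N"
begin

lemma reduced_forward:
  "f \<in> N \<Longrightarrow> is_path \<Gamma> (src \<Gamma> f) p y \<Longrightarrow> reduced \<Gamma> (f # p) \<Longrightarrow> set p \<subseteq> N"
proof (induction p arbitrary: f)
  case (Cons g p)
  then have "g \<in> N" using N_closed by (auto simp: reduced_Cons)
  then show ?case using Cons by (auto simp: reduced_Cons)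
qed auto

lemma forward_reduced: "set p \<subseteq> N \<Longrightarrow> reduced \<Gamma> p"
proof (induction p)
  case (Cons e p)
  then show ?case using N_bar by (cases p) (auto simp: reduced_Cons)
qed auto

text \<open>The return path of one edge gives a minimal cycle \<open>c\<close> inside
  \<open>N\<close>. The claims \<open>backward\<close>, \<open>enter\<close> and \<open>stay\<close>
  show that no path starting on \<open>c\<close> ever leaves \<open>c\<close> and its reversal, so
  by connectedness these are all the edges.\<close>

lemma minimal_cycle_if_all_return:
  assumes ret: "\<And>e. e \<in> N \<Longrightarrow> \<exists>p. is_path \<Gamma> (src \<Gamma> e) p (rng \<Gamma> e) \<and> set p \<subseteq> N"
    and conn: "connected_graph \<Gamma>" and ne: "N \<noteq> {}"
  shows "\<exists>c. minimal_cycle \<Gamma> c \<and> edges \<Gamma> = set c \<union> bar \<Gamma> ` set c \<and> set c \<subseteq> N"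
proof -
  obtain e p where e: "e \<in> N" "is_path \<Gamma> (src \<Gamma> e) p (rng \<Gamma> e)" "set p \<subseteq> N"
    using ret ne by blast
  then obtain c where c: "minimal_cycle \<Gamma> c" "e \<in> set c" "set c \<subseteq> N"
    using minimal_cycle_of_detour[of e p] N_edges N_bar by blast
  \<comment> \<open>Every vertex of \<open>c\<close> is the source of an edge of \<open>c\<close>,
    and by \<open>N_inj\<close> this is the only edge of \<open>N\<close> with that source. Tracing
    backwards in \<open>N\<close> therefore follows \<open>c\<close>.\<close>
  have backward: "set p \<subseteq> set c" if "is_path \<Gamma> x p y" "set p \<subseteq> N" "y \<in> src \<Gamma> ` set c" for x p y
    using that
  proof (induction p arbitrary: y rule: rev_induct)
    case (snoc g p)
    obtain h where h: "h \<in> set c" "src \<Gamma> h = y" using snoc.prems by auto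
    then have gh: "g = h" using snoc.prems c N_inj by (auto simp: is_path_snoc inj_on_def)
    then obtain k where "k \<in> set c" "src \<Gamma> k = rng \<Gamma> g" using minimal_cycle_pred c(1) h(1) by blast
    then have "rng \<Gamma> g \<in> src \<Gamma> ` set c" by (metis imageI)
    then have "set p \<subseteq> set c" using snoc by (auto simp: is_path_snoc)
    then show ?case using gh h by auto
  qed auto
  \<comment> \<open>The edge \<open>f\<close> followed by its return path is a path in
    \<open>N\<close> that ends on \<open>c\<close>, so \<open>backward\<close> puts all of it,
    including \<open>f\<close>, on \<open>c\<close>.\<close>
  have enter: "f \<in> set c" if f: "f \<in> N" "rng \<Gamma> f \<in> src \<Gamma> ` set c" for f
  proof -
    obtain p where "is_path \<Gamma> (src \<Gamma> f) p (rng \<Gamma> f)" "set p \<subseteq> N" using ret f by blast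
    then have "is_path \<Gamma> (rng \<Gamma> f) (f # p) (rng \<Gamma> f)" "set (f # p) \<subseteq> N" using f N_edges by auto
    then show ?thesis using backward f by fastforce
  qed
  \<comment> \<open>At s(h), with \<open>h\<close> on \<open>c\<close>, an edge is either the
    reversal of \<open>h\<close> or belongs to \<open>N\<close> by \<open>N_closed\<close> and then
    to \<open>c\<close> by \<open>enter\<close>. In both cases its source is again on
    \<open>c\<close>.\<close>
  have stay: "set p \<subseteq> set c \<union> bar \<Gamma> ` set c" if "is_path \<Gamma> x p y" "x \<in> src \<Gamma> ` set c" for x p y
    using that
  proof (induction p arbitrary: x)
    case (Cons g p)
    obtain h where h: "h \<in> set c" "src \<Gamma> h = x" using Cons.prems by auto
    have "g \<in> set c \<union> bar \<Gamma> ` set c \<and> src \<Gamma> g \<in> src \<Gamma> ` set c"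
    proof (cases "g = bar \<Gamma> h")
      case True
      obtain k where k: "k \<in> set c" "src \<Gamma> k = rng \<Gamma> h" using minimal_cycle_pred c(1) h(1) by blast
      have "src \<Gamma> g = src \<Gamma> k" using True k h c(3) N_edges src_bar by auto
      then show ?thesis using True h k by (metis UnI2 imageI)
    next
      case False
      then have "g \<in> N" using N_closed[of h g] h c Cons.prems by auto
      then have "g \<in> set c" using enter Cons.prems by auto
      then show ?thesis by auto
    qed
    then show ?case using Cons by auto
  qed auto
  have "edges \<Gamma> \<subseteq> set c \<union> bar \<Gamma> ` set c"
  proof
    fix g assume g: "g \<in> edges \<Gamma>"
    obtain q where "is_path \<Gamma> (src \<Gamma> e) q (rng \<Gamma> g)"
      using conn g e N_edges rng_in src_in unfolding connected_graph_def by blast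
    then have "is_path \<Gamma> (src \<Gamma> e) (q @ [g]) (src \<Gamma> g)" using g is_path_snoc by auto
    then show "g \<in> set c \<union> bar \<Gamma> ` set c" using stay c(2) by fastforce
  qed
  moreover have "set c \<union> bar \<Gamma> ` set c \<subseteq> edges \<Gamma>" using c N_edges bar_in by auto
  ultimately show ?thesis using c by blast
qed

end

section \<open>The branch of an edge of the flow that has no return path\<close>

locale forward_no_return = forward_flow +
  fixes e
  assumes e_N: "e \<in> N"
    and no_return: "is_path \<Gamma> (src \<Gamma> e) p (rng \<Gamma> e) \<Longrightarrow> \<not> set p \<subseteq> N"
begin

lemma e_edge: "e \<in> edges \<Gamma>"
  using e_N N_edges by auto

lemma src_neq_rng: "src \<Gamma> e \<noteq> rng \<Gamma> e"
  using no_return[of "[]"] e_edge rng_in by auto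

text \<open>Rotated to start at \<open>e\<close>, the rest of the cycle is a reduced continuation of
  \<open>e\<close>. It stays in \<open>N\<close> and returns to r(e).\<close>

lemma not_on_minimal_cycle: "minimal_cycle \<Gamma> c \<Longrightarrow> e \<notin> set c"
proof
  assume "minimal_cycle \<Gamma> c" "e \<in> set c"
  then obtain b where b: "minimal_cycle \<Gamma> (e # b)" "is_path \<Gamma> (src \<Gamma> e) b (rng \<Gamma> e)"
    using minimal_cycle_hd by blast
  then have "set b \<subseteq> N" using reduced_forward e_N by (auto simp: minimal_cycle_def rpaths_def)
  then show False using no_return b by blast
qed

text \<open>The edge \<open>e\<close> followed by a branch path is reduced and hence stays in
  \<open>N\<close>; conversely, paths in \<open>N\<close> are reduced because \<open>N\<close> never
  contains an edge together with its reversal. From here on the branch is studied through directed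
  paths in \<open>N\<close>.\<close>

lemma branch_paths_forward:
  "p \<in> branch_paths \<Gamma> e x \<longleftrightarrow> p \<noteq> [] \<and> is_path \<Gamma> (src \<Gamma> e) p x \<and> set p \<subseteq> N"
proof
  assume "p \<in> branch_paths \<Gamma> e x"
  then show "p \<noteq> [] \<and> is_path \<Gamma> (src \<Gamma> e) p x \<and> set p \<subseteq> N"
    using src_neq_rng reduced_forward[OF e_N, of p x]
    by (simp add: branch_paths_def rpaths_def reduced_Cons)
next
  assume p: "p \<noteq> [] \<and> is_path \<Gamma> (src \<Gamma> e) p x \<and> set p \<subseteq> N"
  then have "hd p \<in> N" by auto
  then have "hd p \<noteq> bar \<Gamma> e" using N_bar[OF e_N] by auto
  then show "p \<in> branch_paths \<Gamma> e x" using p src_neq_rng forward_reduced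
    by (simp add: branch_paths_def rpaths_def)
qed

lemma branch_edges_N: "branch_edges e \<subseteq> N"
  by (auto simp: branch_edges_def branch_paths_forward)

lemma branch_vertsE:
  assumes "x \<in> verts (branch \<Gamma> e)"
  obtains p where "is_path \<Gamma> (src \<Gamma> e) p x" "set p \<subseteq> N"
proof (cases "x = src \<Gamma> e")
  case True
  then show thesis using that[of "[]"] e_edge src_in by auto
next
  case False
  then show thesis using assms that by (auto simp: branch_paths_forward)
qed

lemma forward_path_edges:
  "is_path \<Gamma> (src \<Gamma> e) p x \<Longrightarrow> set p \<subseteq> N \<Longrightarrow> set p \<subseteq> branch_edges e"
  using branch_paths_forward[of p x] by (cases "p = []") (auto simp: branch_edges_def)

lemma e_notin_branch: "e \<notin> branch_edges e"
proof
  assume "e \<in> branch_edges e"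
  then obtain p where "p @ [e] \<in> branch_paths \<Gamma> e (src \<Gamma> e)" by (rule branch_edgesE)
  then show False using no_return by (auto simp: branch_paths_forward is_path_snoc)
qed

text \<open>By \<open>N_inj\<close> the last edges of two paths with the same end agree, so both can
  be peeled off from the end.\<close>

lemma forward_path_unique:
  "is_path \<Gamma> (src \<Gamma> e) p x \<Longrightarrow> set p \<subseteq> N \<Longrightarrow> is_path \<Gamma> (src \<Gamma> e) q x \<Longrightarrow> set q \<subseteq> N \<Longrightarrow> p = q"
proof (induction p arbitrary: q x rule: rev_induct)
  \<comment> \<open>Handles the case that one path is used up first. By \<open>N_inj\<close> a
    nonempty closed path at s(e) in \<open>N\<close> ends with \<open>e\<close>, and removing this
    \<open>e\<close> leaves a forbidden return path.\<close>
  have closed: "p = []" if "is_path \<Gamma> (src \<Gamma> e) p (src \<Gamma> e)" "set p \<subseteq> N" for p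
  proof (rule ccontr)
    assume "p \<noteq> []"
    then obtain r g where p: "p = r @ [g]" by (metis rev_exhaust)
    then have "g = e" using that e_N N_inj by (auto simp: is_path_snoc inj_on_def)
    then show False using that p no_return[of r] by (auto simp: is_path_snoc)
  qed
  {
    case Nil
    then show ?case using closed by auto
  next
    case (snoc g p)
    have "q \<noteq> []" using closed[of "p @ [g]"] snoc.prems by auto
    then obtain r h where q: "q = r @ [h]" by (metis rev_exhaust)
    have "g = h" using snoc.prems N_inj by (auto simp: q is_path_snoc inj_on_def)
    then show ?case using snoc by (auto simp: q is_path_snoc)
  }
qed

text \<open>A reduced path in the branch first climbs towards the root \<open>src e\<close> and then descends, so
  it turns at the end of the longest common prefix of the two forward paths to its ends.\<close>

lemma branch_path_decomp:
  assumes "p \<in> rpaths (branch \<Gamma> e) x y"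
    and "is_path \<Gamma> (src \<Gamma> e) r x" "set r \<subseteq> N"
  shows "\<exists>c u w. r = c @ u \<and> is_path \<Gamma> (src \<Gamma> e) (c @ w) y \<and> set (c @ w) \<subseteq> N \<and>
    p = rev (map (bar \<Gamma>) u) @ w \<and> (u = [] \<or> w = [] \<or> hd u \<noteq> hd w)"
  using assms(1)
proof (induction p arbitrary: y rule: rev_induct)
  case Nil
  then show ?case using assms(2,3)
    by (intro exI[of _ r] exI[of _ "[]"]) (auto simp: rpaths_def)
next
  interpret B: sgraph "branch \<Gamma> e" using sgraph_branch e_edge .
  case (snoc f p)
  have f: "f \<in> edges (branch \<Gamma> e)" "src \<Gamma> f = y" "f \<in> edges \<Gamma>"
    and p: "p \<in> rpaths (branch \<Gamma> e) x (rng \<Gamma> f)" and red: "p \<noteq> [] \<Longrightarrow> f \<noteq> bar \<Gamma> (last p)"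
    using snoc.prems edges_branch_subset by (auto simp: rpaths_def B.is_path_snoc reduced_append)
  obtain c u w where cuw: "r = c @ u" "is_path \<Gamma> (src \<Gamma> e) (c @ w) (rng \<Gamma> f)" "set (c @ w) \<subseteq> N"
    "p = rev (map (bar \<Gamma>) u) @ w" "u = [] \<or> w = [] \<or> hd u \<noteq> hd w"
    using snoc.IH[OF p] by blast
  have uN: "set u \<subseteq> edges \<Gamma>" using assms(3) cuw(1) N_edges by auto
  consider "f \<in> N" | g where "f = bar \<Gamma> g" "g \<in> branch_edges e"
    using f(1) branch_edges_N by (auto simp: edges_branch)
  then show ?case
  proof cases
    \<comment> \<open>A forward step prolongs \<open>w\<close>. If \<open>w\<close> is still empty,
      the step may not undo the last step of the climb, which is the reversal of
      \<open>hd u\<close>.\<close>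
    case 1
    have "hd u \<noteq> f" if "u \<noteq> []" "w = []"
    proof -
      have "last p = bar \<Gamma> (hd u)" "p \<noteq> []" using that cuw(4) by (auto simp: last_rev hd_map)
      moreover have "hd u \<in> edges \<Gamma>" using that uN hd_in_set by blast
      ultimately show ?thesis using red bar_bar by metis
    qed
    then show ?thesis using cuw f 1
      by (intro exI[of _ c] exI[of _ u] exI[of _ "w @ [f]"])
        (auto simp: is_path_append hd_append src_in)
  next
    \<comment> \<open>A step towards the root along the reversal of \<open>g\<close>. By
      \<open>N_inj\<close> the forward path \<open>c @ w\<close> ends with \<open>g\<close>. A
      nonempty \<open>w\<close> would mean backtracking, so \<open>g\<close> is the last edge of
      \<open>c\<close> and moves to the front of \<open>u\<close>.\<close>
    case 2
    then have g: "g \<in> N" "g \<in> edges \<Gamma>" "src \<Gamma> g = rng \<Gamma> f"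
      using branch_edges_N N_edges rng_bar by auto
    have w: "w = []"
    proof (rule ccontr)
      assume "w \<noteq> []"
      then obtain w' h where w': "w = w' @ [h]" by (metis rev_exhaust)
      then have "h = g" using cuw(2,3) g N_inj
        by (auto simp: is_path_append inj_on_def)
      then show False using red cuw(4) w' 2 by auto
    qed
    have "c \<noteq> []"
    proof
      assume "c = []"
      then have "src \<Gamma> e = src \<Gamma> g" using cuw(2) w g by auto
      then have "g = e" using N_inj e_N g by (auto simp: inj_on_def)
      then show False using 2 e_notin_branch by auto
    qed
    then obtain c' h where c': "c = c' @ [h]" by (metis rev_exhaust)
    then have "h = g" using cuw(2,3) g w N_inj by (auto simp: is_path_append inj_on_def)
    moreover have "rng \<Gamma> g = y" using f 2 g src_bar by auto
    ultimately show ?thesis using cuw w c' 2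
      by (intro exI[of _ c'] exI[of _ "g # u"] exI[of _ "[]"]) (auto simp: is_path_snoc)
  qed
qed

lemma is_tree_branch: "is_tree (branch \<Gamma> e)"
  unfolding is_tree_def
proof (intro conjI ballI)
  interpret B: sgraph "branch \<Gamma> e" using sgraph_branch e_edge .
  show "sgraph (branch \<Gamma> e)" by (rule B.sgraph_axioms)
  have root: "\<exists>p. is_path (branch \<Gamma> e) (src \<Gamma> e) p x" if x: "x \<in> verts (branch \<Gamma> e)" for x
  proof -
    obtain p where "is_path \<Gamma> (src \<Gamma> e) p x" "set p \<subseteq> N" using branch_vertsE[OF x] .
    then show ?thesis using forward_path_edges
      by (intro exI[of _ p]) (auto simp: is_path_branch[OF e_edge] edges_branch)
  qed
  show conn: "connected_graph (branch \<Gamma> e)"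
    unfolding connected_graph_def
  proof (intro ballI)
    fix x y assume "x \<in> verts (branch \<Gamma> e)" "y \<in> verts (branch \<Gamma> e)"
    then obtain p q where "is_path (branch \<Gamma> e) (src \<Gamma> e) p x" "is_path (branch \<Gamma> e) (src \<Gamma> e) q y"
      using root by meson
    then show "\<exists>es. is_path (branch \<Gamma> e) x es y"
      using B.is_path_rev B.is_path_append by metis
  qed
  fix x y assume xy: "x \<in> verts (branch \<Gamma> e)" "y \<in> verts (branch \<Gamma> e)"
  show "\<exists>!es. es \<in> rpaths (branch \<Gamma> e) x y"
  proof (rule ex_ex1I)
    obtain es where "is_path (branch \<Gamma> e) x es y" using conn xy unfolding connected_graph_def by blast
    then obtain es' where "is_path (branch \<Gamma> e) x es' y" "distinct (map (rng (branch \<Gamma> e)) es' @ [y])"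
      using B.simple_path[of x es y UNIV] by blast
    then show "\<exists>es. es \<in> rpaths (branch \<Gamma> e) x y" using B.distinct_verts_reduced
      by (auto simp: rpaths_def)
  next
    fix p q assume pq: "p \<in> rpaths (branch \<Gamma> e) x y" "q \<in> rpaths (branch \<Gamma> e) x y"
    obtain r where r: "is_path \<Gamma> (src \<Gamma> e) r x" "set r \<subseteq> N" using branch_vertsE[OF xy(1)] .
    obtain c u w where 1: "r = c @ u" "is_path \<Gamma> (src \<Gamma> e) (c @ w) y" "set (c @ w) \<subseteq> N"
      "p = rev (map (bar \<Gamma>) u) @ w" "u = [] \<or> w = [] \<or> hd u \<noteq> hd w"
      using branch_path_decomp[OF pq(1) r] by blast
    obtain c' u' w' where 2: "r = c' @ u'" "is_path \<Gamma> (src \<Gamma> e) (c' @ w') y" "set (c' @ w') \<subseteq> N"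
      "q = rev (map (bar \<Gamma>) u') @ w'" "u' = [] \<or> w' = [] \<or> hd u' \<noteq> hd w'"
      using branch_path_decomp[OF pq(2) r] by blast
    have "c @ w = c' @ w'" using forward_path_unique 1 2 by blast
    moreover have "c @ u = c' @ u'" using 1 2 by auto
    \<comment> \<open>Both \<open>c\<close> and \<open>c'\<close> are the longest common prefix of
      the same two forward paths, those to \<open>x\<close> and to \<open>y\<close>.\<close>
    ultimately have "u = u' \<and> w = w'" using 1(5) 2(5)
      by (auto simp: append_eq_append_conv2 hd_append split: if_splits)
    then show "p = q" using 1 2 by auto
  qed
qed

text \<open>A branch edge outside \<open>N\<close> is the reversal of some \<open>g\<close>
  traversed outwards. The branch path to its range ends with this \<open>g\<close>, so the edge
  points away from s(e).\<close>

lemma points_towards_forward: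
  assumes "f \<in> edges (branch \<Gamma> e)" "points_towards (branch \<Gamma> e) f (src \<Gamma> e)"
  shows "f \<in> N"
proof (rule ccontr)
  assume "f \<notin> N"
  then obtain g where g: "f = bar \<Gamma> g" "g \<in> branch_edges e"
    using assms(1) branch_edges_N by (auto simp: edges_branch)
  then have ge: "g \<in> edges \<Gamma>" using branch_edges_N N_edges by auto
  obtain p where "p @ [g] \<in> branch_paths \<Gamma> e (src \<Gamma> g)" using branch_edgesE g(2) .
  then have "p @ [g] \<in> rpaths (branch \<Gamma> e) (src \<Gamma> e) (rng \<Gamma> f)"
    using branch_paths_rpaths e_edge g ge rng_bar by auto
  then show False using assms(2) g ge bar_bar by (force simp: points_towards_def)
qed

end

section \<open>Transversals and letters\<close>

locale gog_transversal = graph_of_groups \<G> for \<G> :: "('v, 'e, 'g, 'h) gog" +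
  fixes S :: "'e \<Rightarrow> 'g set"
  assumes transversals: "transversals \<G> S"
begin

abbreviation vmult :: "'g \<Rightarrow> 'v \<Rightarrow> 'g \<Rightarrow> 'g" where
  "vmult a x b \<equiv> a \<otimes>\<^bsub>vgrp \<G> x\<^esub> b"

abbreviation vone :: "'v \<Rightarrow> 'g" where
  "vone x \<equiv> \<one>\<^bsub>vgrp \<G> x\<^esub>"

lemma emb_hom: "e \<in> edges \<G> \<Longrightarrow> group_hom (egrp \<G> e) (vgrp \<G> (rng \<G> e)) (emb \<G> e)"
  using emb_mon egrp_group vgrp_group rng_in
  by (simp add: group_hom_def group_hom_axioms_def mon_def)

lemma emb_inj: "e \<in> edges \<G> \<Longrightarrow> inj_on (emb \<G> e) (carrier (egrp \<G> e))"
  using emb_mon by (simp add: mon_def)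

lemma emb_closed:
  "e \<in> edges \<G> \<Longrightarrow> h \<in> carrier (egrp \<G> e) \<Longrightarrow> emb \<G> e h \<in> carrier (vgrp \<G> (rng \<G> e))"
  using group_hom.hom_closed[OF emb_hom] by blast

lemma emb_bar_closed:
  assumes "e \<in> edges \<G>" "h \<in> carrier (egrp \<G> e)"
  shows "emb \<G> (bar \<G> e) h \<in> carrier (vgrp \<G> (src \<G> e))"
  using emb_closed[OF bar_in, of e h] assms egrp_bar src_eq by simp

lemma emb_one: "e \<in> edges \<G> \<Longrightarrow> emb \<G> e \<one>\<^bsub>egrp \<G> e\<^esub> = vone (rng \<G> e)"
  using group_hom.hom_one[OF emb_hom] by blast

lemma emb_mult:
  "e \<in> edges \<G> \<Longrightarrow> h \<in> carrier (egrp \<G> e) \<Longrightarrow> k \<in> carrier (egrp \<G> e) \<Longrightarrow>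
    emb \<G> e (h \<otimes>\<^bsub>egrp \<G> e\<^esub> k) = vmult (emb \<G> e h) (rng \<G> e) (emb \<G> e k)"
  using group_hom.hom_mult[OF emb_hom] by blast

lemma emb_bar_one: "e \<in> edges \<G> \<Longrightarrow> emb \<G> (bar \<G> e) \<one>\<^bsub>egrp \<G> e\<^esub> = vone (src \<G> e)"
  using emb_one[OF bar_in, of e] egrp_bar src_eq by simp

lemma emb_bar_mult:
  "e \<in> edges \<G> \<Longrightarrow> h \<in> carrier (egrp \<G> e) \<Longrightarrow> k \<in> carrier (egrp \<G> e) \<Longrightarrow>
    emb \<G> (bar \<G> e) (h \<otimes>\<^bsub>egrp \<G> e\<^esub> k) = vmult (emb \<G> (bar \<G> e) h) (src \<G> e) (emb \<G> (bar \<G> e) k)"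
  using emb_mult[OF bar_in, of e] egrp_bar src_eq by simp

lemma emb_image_subgroup: "e \<in> edges \<G> \<Longrightarrow> subgroup (emb_image \<G> e) (vgrp \<G> (rng \<G> e))"
  using group_hom.img_is_subgroup[OF emb_hom] by blast

lemma S_closed: "e \<in> edges \<G> \<Longrightarrow> s \<in> S e \<Longrightarrow> s \<in> carrier (vgrp \<G> (rng \<G> e))"
  using transversals by (auto simp: transversals_def)

lemma S_one: "e \<in> edges \<G> \<Longrightarrow> vone (rng \<G> e) \<in> S e"
  using transversals by (auto simp: transversals_def)

text \<open>Passes from cosets to factorisations: an element \<open>s\<close> of \<open>S e\<close>
  lies in the coset of \<open>g\<close> exactly when \<open>g\<close> is \<open>s\<close> times an
  element of the image of \<alpha>_e.\<close>

lemma S_decomp: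
  assumes e: "e \<in> edges \<G>" and g: "g \<in> carrier (vgrp \<G> (rng \<G> e))"
  shows "\<exists>!s. s \<in> S e \<and> (\<exists>h \<in> carrier (egrp \<G> e). g = vmult s (rng \<G> e) (emb \<G> e h))"
proof -
  let ?K = "vgrp \<G> (rng \<G> e)" and ?H = "emb_image \<G> e"
  interpret K: group ?K using vgrp_group rng_in e by blast
  interpret H: subgroup ?H ?K using emb_image_subgroup e .
  have "g <#\<^bsub>?K\<^esub> ?H \<in> lcosets\<^bsub>?K\<^esub> ?H" using g by (auto simp: LCOSETS_def)
  then have ex1: "\<exists>!s. s \<in> S e \<inter> (g <#\<^bsub>?K\<^esub> ?H)" using transversals e by (auto simp: transversals_def)
  have "s \<in> g <#\<^bsub>?K\<^esub> ?H \<longleftrightarrow> (\<exists>h \<in> carrier (egrp \<G> e). g = vmult s (rng \<G> e) (emb \<G> e h))"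
    if s: "s \<in> S e" for s
  proof
    have sc: "s \<in> carrier ?K" using S_closed e s .
    {
      assume "s \<in> g <#\<^bsub>?K\<^esub> ?H"
      then obtain k where k: "k \<in> ?H" "s = g \<otimes>\<^bsub>?K\<^esub> k" by (auto simp: l_coset_def)
      then have "g = s \<otimes>\<^bsub>?K\<^esub> inv\<^bsub>?K\<^esub> k" using g sc H.mem_carrier K.inv_solve_right' by metis
      moreover have "inv\<^bsub>?K\<^esub> k \<in> ?H" using k H.m_inv_closed by blast
      ultimately show "\<exists>h \<in> carrier (egrp \<G> e). g = vmult s (rng \<G> e) (emb \<G> e h)" by auto
    next
      assume "\<exists>h \<in> carrier (egrp \<G> e). g = vmult s (rng \<G> e) (emb \<G> e h)"
      then obtain k where k: "k \<in> ?H" "g = s \<otimes>\<^bsub>?K\<^esub> k" by auto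
      then have "s = g \<otimes>\<^bsub>?K\<^esub> inv\<^bsub>?K\<^esub> k" using g sc H.mem_carrier K.inv_solve_right' by metis
      moreover have "inv\<^bsub>?K\<^esub> k \<in> ?H" using k H.m_inv_closed by blast
      ultimately show "s \<in> g <#\<^bsub>?K\<^esub> ?H" by (auto simp: l_coset_def)
    }
  qed
  then show ?thesis using ex1 by (metis (no_types, lifting) Int_iff)
qed

text \<open>Together with \<open>push_eqI\<close>, this evaluates the two definite descriptions from
  any factorisation of a group element.\<close>

lemma rep_eqI:
  assumes "e \<in> edges \<G>" "s \<in> S e" "h \<in> carrier (egrp \<G> e)"
  shows "rep \<G> S e (vmult s (rng \<G> e) (emb \<G> e h)) = s"
proof -
  interpret K: group "vgrp \<G> (rng \<G> e)" using vgrp_group rng_in assms(1) by blast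
  show ?thesis unfolding rep_def
    using S_decomp[of e "vmult s (rng \<G> e) (emb \<G> e h)"] assms S_closed emb_closed
    by (intro the1_equality) auto
qed

lemma push_eqI:
  assumes "e \<in> edges \<G>" "s \<in> S e" "h \<in> carrier (egrp \<G> e)"
  shows "push \<G> S e (vmult s (rng \<G> e) (emb \<G> e h)) = emb \<G> (bar \<G> e) h"
proof -
  interpret K: group "vgrp \<G> (rng \<G> e)" using vgrp_group rng_in assms(1) by blast
  have "(THE k. k \<in> carrier (egrp \<G> e) \<and> vmult s (rng \<G> e) (emb \<G> e h) = vmult s (rng \<G> e) (emb \<G> e k)) = h"
    using assms S_closed emb_closed emb_inj[OF assms(1)]
    by (intro the_equality) (auto simp: inj_on_def)
  then show ?thesis unfolding push_def rep_eqI[OF assms] by simp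
qed

lemma decompE:
  assumes "e \<in> edges \<G>" "g \<in> carrier (vgrp \<G> (rng \<G> e))"
  obtains s h where "s \<in> S e" "h \<in> carrier (egrp \<G> e)" "g = vmult s (rng \<G> e) (emb \<G> e h)"
    "rep \<G> S e g = s" "push \<G> S e g = emb \<G> (bar \<G> e) h"
  using S_decomp[OF assms] rep_eqI[OF assms(1)] push_eqI[OF assms(1)] by metis

lemma rep_in: "e \<in> edges \<G> \<Longrightarrow> g \<in> carrier (vgrp \<G> (rng \<G> e)) \<Longrightarrow> rep \<G> S e g \<in> S e"
  by (erule (1) decompE) simp

lemma push_closed:
  "e \<in> edges \<G> \<Longrightarrow> g \<in> carrier (vgrp \<G> (rng \<G> e)) \<Longrightarrow> push \<G> S e g \<in> carrier (vgrp \<G> (src \<G> e))"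
  using decompE emb_bar_closed by metis

lemma rep_push_S:
  assumes e: "e \<in> edges \<G>" and s: "s \<in> S e"
  shows "rep \<G> S e s = s" "push \<G> S e s = vone (src \<G> e)"
proof -
  interpret K: group "vgrp \<G> (rng \<G> e)" using vgrp_group rng_in e by blast
  interpret E: group "egrp \<G> e" using egrp_group e .
  have "s = vmult s (rng \<G> e) (emb \<G> e \<one>\<^bsub>egrp \<G> e\<^esub>)" using emb_one e S_closed[OF e s] by simp
  then show "rep \<G> S e s = s" "push \<G> S e s = vone (src \<G> e)"
    using rep_eqI[OF e s E.one_closed] push_eqI[OF e s E.one_closed] emb_bar_one[OF e] by simp_all
qed

lemma rep_push_emb:
  assumes e: "e \<in> edges \<G>" and h: "h \<in> carrier (egrp \<G> e)"
  shows "rep \<G> S e (emb \<G> e h) = vone (rng \<G> e)" "push \<G> S e (emb \<G> e h) = emb \<G> (bar \<G> e) h"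
proof -
  interpret K: group "vgrp \<G> (rng \<G> e)" using vgrp_group rng_in e by blast
  have "emb \<G> e h = vmult (vone (rng \<G> e)) (rng \<G> e) (emb \<G> e h)" using emb_closed[OF e h] by simp
  then show "rep \<G> S e (emb \<G> e h) = vone (rng \<G> e)" "push \<G> S e (emb \<G> e h) = emb \<G> (bar \<G> e) h"
    using rep_eqI[OF e S_one h] push_eqI[OF e S_one h] e by simp_all
qed

text \<open>If the product has representative 1 it lies in the image of \<alpha>_e, hence so does
  \<open>s\<close>, whose representative is \<open>s\<close> itself. This is what prevents the
  action from creating new backtrackings.\<close>

lemma rep_emb_mult_one:
  assumes e: "e \<in> edges \<G>" and h: "h \<in> carrier (egrp \<G> e)" and s: "s \<in> S e"
    and one: "rep \<G> S e (vmult (emb \<G> e h) (rng \<G> e) s) = vone (rng \<G> e)"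
  shows "s = vone (rng \<G> e)"
proof -
  let ?K = "vgrp \<G> (rng \<G> e)"
  interpret K: group ?K using vgrp_group rng_in e by blast
  interpret E: group "egrp \<G> e" using egrp_group e .
  interpret A: group_hom "egrp \<G> e" ?K "emb \<G> e" using emb_hom e .
  have c: "s \<in> carrier ?K" "emb \<G> e h \<in> carrier ?K" using S_closed emb_closed e s h by auto
  have hs: "emb \<G> e h \<otimes>\<^bsub>?K\<^esub> s \<in> carrier ?K" using c by simp
  obtain s' k where k: "k \<in> carrier (egrp \<G> e)" "emb \<G> e h \<otimes>\<^bsub>?K\<^esub> s = s' \<otimes>\<^bsub>?K\<^esub> emb \<G> e k"
    "rep \<G> S e (emb \<G> e h \<otimes>\<^bsub>?K\<^esub> s) = s'"
    using decompE[OF e hs] by metis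
  then have "emb \<G> e h \<otimes>\<^bsub>?K\<^esub> s = emb \<G> e k" using one emb_closed e by simp
  then have "s = inv\<^bsub>?K\<^esub> (emb \<G> e h) \<otimes>\<^bsub>?K\<^esub> emb \<G> e k"
    using c K.inv_solve_left emb_closed[OF e k(1)] by metis
  also have "\<dots> = emb \<G> e (inv\<^bsub>egrp \<G> e\<^esub> h \<otimes>\<^bsub>egrp \<G> e\<^esub> k)" using h k(1) by simp
  finally have "s = emb \<G> e (inv\<^bsub>egrp \<G> e\<^esub> h \<otimes>\<^bsub>egrp \<G> e\<^esub> k)" .
  moreover have "inv\<^bsub>egrp \<G> e\<^esub> h \<otimes>\<^bsub>egrp \<G> e\<^esub> k \<in> carrier (egrp \<G> e)" using h k(1) by simp
  ultimately show ?thesis using rep_push_S(1)[OF e s] rep_push_emb(1)[OF e] by metis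
qed

text \<open>The cocycle identity behind the action law. With x = s \<alpha>_e(h) and c s = t
  \<alpha>_e(k) one gets c x = t \<alpha>_e(k h).\<close>

lemma rep_push_mult:
  assumes e: "e \<in> edges \<G>" and "c \<in> carrier (vgrp \<G> (rng \<G> e))" "x \<in> carrier (vgrp \<G> (rng \<G> e))"
  shows "rep \<G> S e (vmult c (rng \<G> e) x) = rep \<G> S e (vmult c (rng \<G> e) (rep \<G> S e x))"
    and "push \<G> S e (vmult c (rng \<G> e) x) =
      vmult (push \<G> S e (vmult c (rng \<G> e) (rep \<G> S e x))) (src \<G> e) (push \<G> S e x)"
proof -
  let ?K = "vgrp \<G> (rng \<G> e)"
  interpret K: group ?K using vgrp_group rng_in e by blast
  interpret E: group "egrp \<G> e" using egrp_group e .
  obtain s h where x: "s \<in> S e" "h \<in> carrier (egrp \<G> e)" "x = s \<otimes>\<^bsub>?K\<^esub> emb \<G> e h"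
    "rep \<G> S e x = s" "push \<G> S e x = emb \<G> (bar \<G> e) h"
    using decompE e assms(3) .
  have sc: "s \<in> carrier ?K" "emb \<G> e h \<in> carrier ?K" using S_closed emb_closed e x by auto
  then have "c \<otimes>\<^bsub>?K\<^esub> s \<in> carrier ?K" using assms(2) by simp
  then obtain t k where t: "t \<in> S e" "k \<in> carrier (egrp \<G> e)" "c \<otimes>\<^bsub>?K\<^esub> s = t \<otimes>\<^bsub>?K\<^esub> emb \<G> e k"
    "rep \<G> S e (c \<otimes>\<^bsub>?K\<^esub> s) = t" "push \<G> S e (c \<otimes>\<^bsub>?K\<^esub> s) = emb \<G> (bar \<G> e) k"
    using decompE e by blast
  have "c \<otimes>\<^bsub>?K\<^esub> x = (c \<otimes>\<^bsub>?K\<^esub> s) \<otimes>\<^bsub>?K\<^esub> emb \<G> e h" using x sc assms(2) K.m_assoc by simp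
  also have "\<dots> = t \<otimes>\<^bsub>?K\<^esub> emb \<G> e (k \<otimes>\<^bsub>egrp \<G> e\<^esub> h)"
    using t x e sc S_closed emb_closed emb_mult K.m_assoc by simp
  finally have cx: "c \<otimes>\<^bsub>?K\<^esub> x = t \<otimes>\<^bsub>?K\<^esub> emb \<G> e (k \<otimes>\<^bsub>egrp \<G> e\<^esub> h)" .
  have kh: "k \<otimes>\<^bsub>egrp \<G> e\<^esub> h \<in> carrier (egrp \<G> e)" using t x by simp
  show "rep \<G> S e (c \<otimes>\<^bsub>?K\<^esub> x) = rep \<G> S e (c \<otimes>\<^bsub>?K\<^esub> rep \<G> S e x)"
    unfolding cx using rep_eqI[OF e t(1) kh] t x by simp
  show "push \<G> S e (c \<otimes>\<^bsub>?K\<^esub> x) = vmult (push \<G> S e (c \<otimes>\<^bsub>?K\<^esub> rep \<G> S e x)) (src \<G> e) (push \<G> S e x)"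
    unfolding cx using push_eqI[OF e t(1) kh] t x emb_bar_mult e by simp
qed

lemma not_emb_ontoE:
  assumes e: "e \<in> edges \<G>" and "\<not> emb_onto \<G> e"
  obtains s where "s \<in> S e" "s \<noteq> vone (rng \<G> e)"
proof -
  interpret K: group "vgrp \<G> (rng \<G> e)" using vgrp_group rng_in e by blast
  obtain g where g: "g \<in> carrier (vgrp \<G> (rng \<G> e))" "g \<notin> emb_image \<G> e"
    using assms(2) emb_closed[OF e] by (auto simp: emb_onto_def)
  obtain s h where "s \<in> S e" "h \<in> carrier (egrp \<G> e)" "g = vmult s (rng \<G> e) (emb \<G> e h)"
    using decompE[OF e g(1)] by metis
  then have "s \<noteq> vone (rng \<G> e)" using g emb_closed[OF e] by auto
  then show thesis using that \<open>s \<in> S e\<close> by blast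
qed

lemma emb_onto_S:
  assumes e: "e \<in> edges \<G>" and "emb_onto \<G> e" and s: "s \<in> S e"
  shows "s = vone (rng \<G> e)"
proof -
  obtain h where "h \<in> carrier (egrp \<G> e)" "s = emb \<G> e h"
    using assms(2) S_closed[OF e s] by (auto simp: emb_onto_def)
  then show ?thesis using rep_push_S(1)[OF e s] rep_push_emb(1)[OF e] by simp
qed

lemma emb_onto_index:
  assumes e: "e \<in> edges \<G>" and "emb_onto \<G> e"
  shows "card (lcosets\<^bsub>vgrp \<G> (rng \<G> e)\<^esub> (emb_image \<G> e)) = 1"
proof -
  let ?K = "vgrp \<G> (rng \<G> e)"
  interpret K: group ?K using vgrp_group rng_in e by blast
  have "a <#\<^bsub>?K\<^esub> carrier ?K = carrier ?K" if "a \<in> carrier ?K" for a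
    using that K.coset_join3[OF that K.subgroup_self] by simp
  then have "lcosets\<^bsub>?K\<^esub> (carrier ?K) = {carrier ?K}"
    using K.one_closed by (auto simp: LCOSETS_def)
  then show ?thesis using assms(2) by (simp add: emb_onto_def)
qed

text \<open>The reversal of \<open>e\<close> has index 1, so nonsingularity forbids it to be the
  only edge with range s(e). Hence reduced paths can be continued beyond \<open>e\<close>.\<close>

lemma nonsingular_exit:
  assumes "nonsingular \<G>" and e: "e \<in> edges \<G>" "emb_onto \<G> (bar \<G> e)"
  obtains f where "f \<in> edges \<G>" "rng \<G> f = src \<G> e" "f \<noteq> bar \<G> e"
  using assms emb_onto_index[OF bar_in[OF e(1)] e(2)] bar_in[OF e(1)] src_eq[OF e(1)]
  unfolding nonsingular_def by fastforce

end

section \<open>The boundary\<close>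

lemma (in sgraph) is_path_successively:
  "es \<noteq> [] \<Longrightarrow> is_path \<Gamma> x es y \<longleftrightarrow> set es \<subseteq> edges \<Gamma> \<and> rng \<Gamma> (hd es) = x \<and>
     src \<Gamma> (last es) = y \<and> successively (\<lambda>e f. src \<Gamma> e = rng \<Gamma> f) es"
proof (induction es arbitrary: x)
  case (Cons e es)
  show ?case
  proof (cases "es = []")
    case True
    then show ?thesis using src_in by auto
  next
    case False
    then show ?thesis using Cons.IH[of "src \<Gamma> e"] by (auto simp: successively_Cons)
  qed
qed auto

context gog_transversal
begin

lemma vgrp_monoid: "x \<in> verts \<G> \<Longrightarrow> monoid (vgrp \<G> x)"
  using vgrp_group group.is_monoid by blast

lemma vone_closed: "x \<in> verts \<G> \<Longrightarrow> vone x \<in> carrier (vgrp \<G> x)"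
  using vgrp_monoid monoid.one_closed by blast

lemma vmult_closed:
  "x \<in> verts \<G> \<Longrightarrow> a \<in> carrier (vgrp \<G> x) \<Longrightarrow> b \<in> carrier (vgrp \<G> x) \<Longrightarrow>
    vmult a x b \<in> carrier (vgrp \<G> x)"
  using vgrp_monoid monoid.m_closed by metis

definition letters :: "('g \<times> 'e) set" where
  "letters = {a. snd a \<in> edges \<G> \<and> fst a \<in> S (snd a)}"

text \<open>Reducedness of a word seen at two neighbouring letters. Only the edge of the first
  letter matters, a fact used when initial segments are exchanged.\<close>

definition admissible :: "'g \<times> 'e \<Rightarrow> 'g \<times> 'e \<Rightarrow> bool" where
  "admissible a b \<longleftrightarrow> src \<G> (snd a) = rng \<G> (snd b) \<and>
     b \<noteq> (vone (src \<G> (snd a)), bar \<G> (snd a))"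

lemma gpaths_Nil [simp]: "[] \<in> gpaths \<G> S x \<longleftrightarrow> x \<in> verts \<G>"
  by (auto simp: gpaths_def gwords_def reduced_gword_def vone_closed)

lemma gpaths_iff:
  assumes "p \<noteq> []"
  shows "p \<in> gpaths \<G> S x \<longleftrightarrow>
    set p \<subseteq> letters \<and> rng \<G> (snd (hd p)) = x \<and> successively admissible p"
proof
  assume "p \<in> gpaths \<G> S x"
  then obtain y where y: "is_path \<G> x (map snd p) y" "\<And>a. a \<in> set p \<Longrightarrow> fst a \<in> S (snd a)"
    and red: "\<And>i. Suc i < length p \<Longrightarrow> snd (p ! i) = bar \<G> (snd (p ! Suc i)) \<Longrightarrow>
      fst (p ! Suc i) \<noteq> vone (rng \<G> (snd (p ! Suc i)))"
    by (fastforce simp: gpaths_def gwords_def reduced_gword_def)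
  have ed: "snd a \<in> edges \<G>" if "a \<in> set p" for a using is_path_edges[OF y(1)] that by auto
  have sl: "set p \<subseteq> letters" using ed y(2) by (fastforce simp: letters_def)
  moreover have "rng \<G> (snd (hd p)) = x" using y(1) assms by (cases p) auto
  moreover have "successively admissible p"
    unfolding successively_conv_nth
  proof (intro allI impI)
    fix i assume i: "Suc i < length p"
    then have e: "snd (p ! i) \<in> edges \<G>" "snd (p ! Suc i) \<in> edges \<G>" using ed by simp_all
    have "successively (\<lambda>e f. src \<G> e = rng \<G> f) (map snd p)"
      using y(1) assms is_path_successively[of "map snd p"] by simp
    then have "src \<G> (snd (p ! i)) = rng \<G> (snd (p ! Suc i))"
      using i by (simp add: successively_conv_nth)
    then show "admissible (p ! i) (p ! Suc i)"
      using red[OF i] bar_bar e unfolding admissible_def by (metis fst_conv snd_conv)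
  qed
  ultimately show "set p \<subseteq> letters \<and> rng \<G> (snd (hd p)) = x \<and> successively admissible p" by blast
next
  assume r: "set p \<subseteq> letters \<and> rng \<G> (snd (hd p)) = x \<and> successively admissible p"
  have l: "snd a \<in> edges \<G>" "fst a \<in> S (snd a)" if "a \<in> set p" for a
    using r that by (auto simp: letters_def)
  let ?y = "src \<G> (last (map snd p))"
  have "successively (\<lambda>e f. src \<G> e = rng \<G> f) (map snd p)"
    using r by (auto simp: successively_conv_nth admissible_def)
  then have path: "is_path \<G> x (map snd p) ?y"
    using assms r l(1) is_path_successively[of "map snd p" x ?y] by (auto simp: hd_map)
  then have "vone ?y \<in> carrier (vgrp \<G> ?y)"
    using vone_closed is_path_target by blast
  then have "(p, vone ?y) \<in> gwords \<G> x ?y"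
    using path l S_closed by (fastforce simp: gwords_def)
  moreover have "reduced_gword \<G> S (p, vone ?y)"
    unfolding reduced_gword_def
  proof (clarsimp, intro conjI ballI allI impI)
    fix a assume "a \<in> set p"
    then show "case a of (g, e) \<Rightarrow> g \<in> S e" using l by auto
  next
    fix i assume i: "Suc i < length p \<and> snd (p ! i) = bar \<G> (snd (p ! Suc i))"
    then have e: "snd (p ! Suc i) \<in> edges \<G>" using l(1) by simp
    have "admissible (p ! i) (p ! Suc i)" using r i by (auto simp: successively_conv_nth)
    then show "fst (p ! Suc i) \<noteq> vone (rng \<G> (snd (p ! Suc i)))"
      using i e bar_bar by (auto simp: admissible_def prod_eq_iff)
  qed
  ultimately show "p \<in> gpaths \<G> S x" by (auto simp: gpaths_def)
qed

text \<open>The conditions on a nonempty path concern its first vertex, single letters and adjacent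
  pairs, so those on all initial segments reduce to the same data.\<close>

lemma boundary_iff:
  "\<xi> \<in> boundary \<G> S x \<longleftrightarrow> rng \<G> (snd (\<xi> 0)) = x \<and> (\<forall>n. \<xi> n \<in> letters) \<and>
     (\<forall>n. admissible (\<xi> n) (\<xi> (Suc n)))"
proof
  assume "\<xi> \<in> boundary \<G> S x"
  then have p: "map \<xi> [0..<n] \<in> gpaths \<G> S x" for n by (auto simp: boundary_def)
  have p: "set (map \<xi> [0..<Suc n]) \<subseteq> letters" "rng \<G> (snd (hd (map \<xi> [0..<Suc n]))) = x"
    "successively admissible (map \<xi> [0..<Suc n])" for n
    using p[of "Suc n"] gpaths_iff[of "map \<xi> [0..<Suc n]" x] by simp_all
  have "rng \<G> (snd (\<xi> 0)) = x" using p(2)[of 0] by simp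
  moreover have "\<xi> n \<in> letters" for n using p(1)[of n] by simp
  moreover have "admissible (\<xi> n) (\<xi> (Suc n))" for n
    using p(3)[of "Suc n"] successively_nth[of admissible "map \<xi> [0..<Suc (Suc n)]" n]
    by (simp add: nth_append)
  ultimately show "rng \<G> (snd (\<xi> 0)) = x \<and> (\<forall>n. \<xi> n \<in> letters) \<and>
     (\<forall>n. admissible (\<xi> n) (\<xi> (Suc n)))" by blast
next
  assume r: "rng \<G> (snd (\<xi> 0)) = x \<and> (\<forall>n. \<xi> n \<in> letters) \<and> (\<forall>n. admissible (\<xi> n) (\<xi> (Suc n)))"
  have "snd (\<xi> 0) \<in> edges \<G>" using r by (auto simp: letters_def)
  then have x: "x \<in> verts \<G>" using r rng_in by auto
  have "map \<xi> [0..<n] \<in> gpaths \<G> S x" for n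
  proof (cases n)
    case 0
    then show ?thesis using x by simp
  next
    case (Suc m)
    then have "map \<xi> [0..<n] \<noteq> []" "rng \<G> (snd (hd (map \<xi> [0..<n]))) = x"
      using r by (auto simp: hd_map simp del: upt_Suc)
    moreover have "successively admissible (map \<xi> [0..<n])"
      using r by (auto simp: successively_conv_nth)
    ultimately show ?thesis using r gpaths_iff by (auto simp del: upt_Suc)
  qed
  then show "\<xi> \<in> boundary \<G> S x" by (auto simp: boundary_def)
qed

lemma boundary_edge: "\<xi> \<in> boundary \<G> S x \<Longrightarrow> snd (\<xi> n) \<in> edges \<G>"
  by (simp add: boundary_iff letters_def)

lemma boundary_S: "\<xi> \<in> boundary \<G> S x \<Longrightarrow> fst (\<xi> n) \<in> S (snd (\<xi> n))"
  by (simp add: boundary_iff letters_def)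

lemma boundary_carrier:
  "\<xi> \<in> boundary \<G> S x \<Longrightarrow> fst (\<xi> n) \<in> carrier (vgrp \<G> (rng \<G> (snd (\<xi> n))))"
  using boundary_edge boundary_S S_closed by blast

lemma boundary_src: "\<xi> \<in> boundary \<G> S x \<Longrightarrow> src \<G> (snd (\<xi> n)) = rng \<G> (snd (\<xi> (Suc n)))"
  by (auto simp: boundary_iff admissible_def)

lemma boundary_rng: "\<xi> \<in> boundary \<G> S x \<Longrightarrow> rng \<G> (snd (\<xi> 0)) = x"
  by (auto simp: boundary_iff)

lemma boundary_vert: "\<xi> \<in> boundary \<G> S x \<Longrightarrow> x \<in> verts \<G>"
  using boundary_rng boundary_edge rng_in by blast

lemma boundary_Cons:
  "case_nat a \<xi> \<in> boundary \<G> S x \<longleftrightarrow> a \<in> letters \<and> rng \<G> (snd a) = x \<and>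
     admissible a (\<xi> 0) \<and> \<xi> \<in> boundary \<G> S (src \<G> (snd a))"
proof -
  have "(\<forall>n. P n) \<longleftrightarrow> P 0 \<and> (\<forall>n. P (Suc n))" for P :: "nat \<Rightarrow> bool"
    by (metis not0_implies_Suc)
  note all = this[of "\<lambda>n. case_nat a \<xi> n \<in> letters"]
    this[of "\<lambda>n. admissible (case_nat a \<xi> n) (case_nat a \<xi> (Suc n))"]
  show ?thesis unfolding boundary_iff all by (auto simp: admissible_def)
qed

lemma case_nat_tl: "case_nat (\<xi> 0) (\<lambda>n. \<xi> (Suc n)) = \<xi>"
  by (auto split: nat.split)

lemma boundary_tl:
  assumes "\<xi> \<in> boundary \<G> S x"
  shows "(\<lambda>n. \<xi> (Suc n)) \<in> boundary \<G> S (src \<G> (snd (\<xi> 0)))"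
  using assms boundary_Cons[of "\<xi> 0" "\<lambda>n. \<xi> (Suc n)" x] by (simp add: case_nat_tl)

lemma boundary_path: "\<xi> \<in> boundary \<G> S x \<Longrightarrow> is_path \<G> x (map (snd \<circ> \<xi>) [0..<n]) (rng \<G> (snd (\<xi> n)))"
proof (induction n)
  case 0
  then show ?case using boundary_rng boundary_vert by auto
next
  case (Suc n)
  then show ?case using boundary_edge boundary_src by (auto simp: is_path_snoc)
qed

text \<open>Dependent choice along \<open>admissible\<close>. It supplies points that stay in a trap
  and points that run around a cycle.\<close>

lemma boundary_exists:
  assumes a: "a \<in> X" "X \<subseteq> letters" and step: "\<And>a. a \<in> X \<Longrightarrow> \<exists>b \<in> X. admissible a b"
  obtains \<xi> where "\<xi> \<in> boundary \<G> S (rng \<G> (snd a))" "\<xi> 0 = a" "\<And>n. \<xi> n \<in> X"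
proof -
  have "\<exists>\<xi>. \<forall>n. (\<xi> n \<in> X \<and> (n = 0 \<longrightarrow> \<xi> n = a)) \<and> admissible (\<xi> n) (\<xi> (Suc n))"
    using a step by (intro dependent_nat_choice) blast+
  then obtain \<xi> where "\<xi> 0 = a" "\<And>n. \<xi> n \<in> X" "\<And>n. admissible (\<xi> n) (\<xi> (Suc n))"
    by blast
  moreover from this have "\<xi> n \<in> letters" for n using a(2) by blast
  ultimately show thesis using that by (auto simp: boundary_iff)
qed

section \<open>The action\<close>

lemma carry_Cons:
  "carry \<G> S g (case_nat (a, e) \<xi>) (Suc n) =
     carry \<G> S (push \<G> S e (vmult g (rng \<G> e) a)) \<xi> n"
  by (induction n) simp_all

text \<open>Turns the definition through \<open>carry\<close> into a recursion on the first letter: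
  the representative is emitted and the pushed element acts on the tail.\<close>

lemma act_elt_Cons:
  "act_elt \<G> S g (case_nat (a, e) \<xi>) =
     case_nat (rep \<G> S e (vmult g (rng \<G> e) a), e) (act_elt \<G> S (push \<G> S e (vmult g (rng \<G> e) a)) \<xi>)"
  by (rule ext) (simp add: act_elt_def carry_Cons split: nat.split del: carry.simps(2))

lemma snd_act_elt [simp]: "snd (act_elt \<G> S g \<xi> n) = snd (\<xi> n)"
  by (simp add: act_elt_def)

context
  fixes x g \<xi>
  assumes \<xi>: "\<xi> \<in> boundary \<G> S x" and g: "g \<in> carrier (vgrp \<G> x)"
begin

lemma carry_mult_closed:
  "carry \<G> S g \<xi> n \<in> carrier (vgrp \<G> (rng \<G> (snd (\<xi> n)))) \<and>
   vmult (carry \<G> S g \<xi> n) (rng \<G> (snd (\<xi> n))) (fst (\<xi> n)) \<in> carrier (vgrp \<G> (rng \<G> (snd (\<xi> n))))"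
proof (induction n)
  have m: "vmult c (rng \<G> (snd (\<xi> n))) (fst (\<xi> n)) \<in> carrier (vgrp \<G> (rng \<G> (snd (\<xi> n))))"
    if "c \<in> carrier (vgrp \<G> (rng \<G> (snd (\<xi> n))))" for c n
    using vmult_closed[OF rng_in[OF boundary_edge[OF \<xi>]] that boundary_carrier[OF \<xi>]] .
  {
    case 0
    then show ?case using m[of g 0] g boundary_rng[OF \<xi>] by simp
  next
    case (Suc n)
    then have "carry \<G> S g \<xi> (Suc n) \<in> carrier (vgrp \<G> (rng \<G> (snd (\<xi> (Suc n)))))"
      using push_closed[OF boundary_edge[OF \<xi>], of _ n] boundary_src[OF \<xi>] by simp
    then show ?case using m by blast
  }
qed

lemmas carry_closed = carry_mult_closed[THEN conjunct1]
lemmas carry_mult = carry_mult_closed[THEN conjunct2]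

lemma carry_SucE:
  obtains h where "h \<in> carrier (egrp \<G> (snd (\<xi> n)))"
    "carry \<G> S g \<xi> (Suc n) = emb \<G> (bar \<G> (snd (\<xi> n))) h"
  using decompE[OF boundary_edge[OF \<xi>] carry_mult] by (metis carry.simps(2))

text \<open>Only a new backtracking could go wrong. The carry that reaches a letter with edge
  \<open>bar \<G> e\<close> after \<open>e\<close> lies in the image of \<alpha> at that reversed
  edge, so by \<open>rep_emb_mult_one\<close> a letter that becomes trivial was trivial
  before.\<close>

lemma act_elt_boundary: "act_elt \<G> S g \<xi> \<in> boundary \<G> S x"
  unfolding boundary_iff
proof (intro conjI allI)
  show "rng \<G> (snd (act_elt \<G> S g \<xi> 0)) = x" using boundary_rng[OF \<xi>] by simp
  fix n
  show "act_elt \<G> S g \<xi> n \<in> letters"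
    using rep_in[OF boundary_edge[OF \<xi>] carry_mult] boundary_edge[OF \<xi>]
    by (simp add: letters_def act_elt_def)
  let ?e = "snd (\<xi> n)"
  have e: "?e \<in> edges \<G>" using boundary_edge[OF \<xi>] .
  have adm: "admissible (\<xi> n) (\<xi> (Suc n))" using \<xi> by (simp add: boundary_iff)
  show "admissible (act_elt \<G> S g \<xi> n) (act_elt \<G> S g \<xi> (Suc n))"
  proof (rule ccontr)
    assume "\<not> ?thesis"
    then have 1: "snd (\<xi> (Suc n)) = bar \<G> ?e" "fst (act_elt \<G> S g \<xi> (Suc n)) = vone (src \<G> ?e)"
      using boundary_src[OF \<xi>] by (auto simp: admissible_def prod_eq_iff)
    obtain h where h: "h \<in> carrier (egrp \<G> ?e)" "carry \<G> S g \<xi> (Suc n) = emb \<G> (bar \<G> ?e) h"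
      by (rule carry_SucE)
    have "rep \<G> S (bar \<G> ?e) (vmult (emb \<G> (bar \<G> ?e) h) (rng \<G> (bar \<G> ?e)) (fst (\<xi> (Suc n)))) =
        vone (rng \<G> (bar \<G> ?e))"
      using 1 h rng_bar[OF e] by (simp add: act_elt_def)
    then have "fst (\<xi> (Suc n)) = vone (rng \<G> (bar \<G> ?e))"
      using rep_emb_mult_one[OF bar_in[OF e]] h egrp_bar[OF e] boundary_S[OF \<xi>, of "Suc n"] 1 by simp
    then show False using adm 1 rng_bar[OF e] by (auto simp: admissible_def prod_eq_iff)
  qed
qed

text \<open>By \<open>rep_push_mult\<close> the carry of a product is at each index the product of
  the two carries, the one for \<open>k\<close> being taken along the point already moved by
  \<open>g\<close>.\<close>

lemma act_elt_mult:
  assumes k: "k \<in> carrier (vgrp \<G> x)"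
  shows "act_elt \<G> S k (act_elt \<G> S g \<xi>) = act_elt \<G> S (vmult k x g) \<xi>"
proof -
  let ?\<eta> = "act_elt \<G> S g \<xi>"
  have *: "carry \<G> S (vmult k x g) \<xi> n = vmult (carry \<G> S k ?\<eta> n) (rng \<G> (snd (\<xi> n))) (carry \<G> S g \<xi> n) \<and>
    carry \<G> S k ?\<eta> n \<in> carrier (vgrp \<G> (rng \<G> (snd (\<xi> n))))" for n
  proof (induction n)
    case 0
    then show ?case using k boundary_rng[OF \<xi>] by simp
  next
    case (Suc n)
    let ?e = "snd (\<xi> n)" and ?a = "fst (\<xi> n)" and ?c = "carry \<G> S k ?\<eta> n" and ?d = "carry \<G> S g \<xi> n"
    have e: "?e \<in> edges \<G>" using boundary_edge[OF \<xi>] .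
    interpret K: group "vgrp \<G> (rng \<G> ?e)" using vgrp_group rng_in e by blast
    have cl: "?c \<in> carrier (vgrp \<G> (rng \<G> ?e))" "?d \<in> carrier (vgrp \<G> (rng \<G> ?e))"
      "?a \<in> carrier (vgrp \<G> (rng \<G> ?e))"
      using Suc carry_closed boundary_carrier[OF \<xi>] by auto
    have r: "fst (?\<eta> n) = rep \<G> S ?e (vmult ?d (rng \<G> ?e) ?a)" by (simp add: act_elt_def)
    have "fst (?\<eta> n) \<in> carrier (vgrp \<G> (rng \<G> ?e))"
      using r rep_in[OF e carry_mult] S_closed[OF e] by simp
    then have "carry \<G> S k ?\<eta> (Suc n) \<in> carrier (vgrp \<G> (src \<G> ?e))"
      using push_closed[OF e] cl by simp
    moreover have "carry \<G> S (vmult k x g) \<xi> (Suc n) =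
      push \<G> S ?e (vmult ?c (rng \<G> ?e) (vmult ?d (rng \<G> ?e) ?a))"
      using Suc cl K.m_assoc by simp
    ultimately show ?case
      using rep_push_mult(2)[OF e cl(1), of "vmult ?d (rng \<G> ?e) ?a"] cl r boundary_src[OF \<xi>] by simp
  qed
  show ?thesis
  proof
    fix n
    let ?e = "snd (\<xi> n)" and ?a = "fst (\<xi> n)" and ?c = "carry \<G> S k ?\<eta> n" and ?d = "carry \<G> S g \<xi> n"
    have e: "?e \<in> edges \<G>" using boundary_edge[OF \<xi>] .
    interpret K: group "vgrp \<G> (rng \<G> ?e)" using vgrp_group rng_in e by blast
    have cl: "?c \<in> carrier (vgrp \<G> (rng \<G> ?e))" "?d \<in> carrier (vgrp \<G> (rng \<G> ?e))"
      "?a \<in> carrier (vgrp \<G> (rng \<G> ?e))"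
      using * carry_closed boundary_carrier[OF \<xi>] by auto
    have r: "fst (?\<eta> n) = rep \<G> S ?e (vmult ?d (rng \<G> ?e) ?a)" by (simp add: act_elt_def)
    \<comment> \<open>The definition is instantiated at \<open>k\<close> so that the inner action by
      \<open>g\<close> stays folded.\<close>
    have "fst (act_elt \<G> S k ?\<eta> n) = rep \<G> S ?e (vmult ?c (rng \<G> ?e) (fst (?\<eta> n)))"
      by (simp add: act_elt_def[of _ _ k])
    also have "\<dots> = rep \<G> S ?e (vmult (carry \<G> S (vmult k x g) \<xi> n) (rng \<G> ?e) ?a)"
      using rep_push_mult(1)[OF e cl(1), of "vmult ?d (rng \<G> ?e) ?a"] cl r * K.m_assoc by simp
    finally show "act_elt \<G> S k ?\<eta> n = act_elt \<G> S (vmult k x g) \<xi> n"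
      by (simp add: prod_eq_iff) (simp add: act_elt_def)
  qed
qed

end

lemma act_elt_one:
  assumes \<xi>: "\<xi> \<in> boundary \<G> S x"
  shows "act_elt \<G> S (vone x) \<xi> = \<xi>"
proof -
  have s: "vmult (vone (rng \<G> (snd (\<xi> n)))) (rng \<G> (snd (\<xi> n))) (fst (\<xi> n)) = fst (\<xi> n)" for n
    using monoid.l_one[OF vgrp_monoid[OF rng_in[OF boundary_edge[OF \<xi>]]] boundary_carrier[OF \<xi>]] .
  have c: "carry \<G> S (vone x) \<xi> n = vone (rng \<G> (snd (\<xi> n)))" for n
  proof (induction n)
    case 0
    then show ?case using boundary_rng[OF \<xi>] by simp
  next
    case (Suc n)
    then show ?case using s rep_push_S(2)[OF boundary_edge[OF \<xi>] boundary_S[OF \<xi>]]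
      boundary_src[OF \<xi>] by simp
  qed
  show ?thesis
    using c s rep_push_S(1)[OF boundary_edge[OF \<xi>] boundary_S[OF \<xi>]]
    by (auto simp: act_elt_def)
qed

lemma letter_one: "e \<in> edges \<G> \<Longrightarrow> (vone (rng \<G> e), e) \<in> letters"
  using S_one by (simp add: letters_def)

lemma act_edge_boundary:
  assumes e: "e \<in> edges \<G>" and \<xi>: "\<xi> \<in> boundary \<G> S (src \<G> e)"
  shows "act_edge \<G> e \<xi> \<in> boundary \<G> S (rng \<G> e)"
proof (cases "\<xi> 0 = (vone (src \<G> e), bar \<G> e)")
  case True
  then show ?thesis using boundary_tl[OF \<xi>] src_bar[OF e] by (simp add: act_edge_def)
next
  case False
  then show ?thesis using \<xi> letter_one[OF e] boundary_rng[OF \<xi>]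
    by (simp add: act_edge_def boundary_Cons admissible_def)
qed

text \<open>If \<xi> starts with \<open>e\<close> and trivial element, that letter is removed; the
  rest cannot start with the trivial reversal because \<xi> is reduced, so \<open>e\<close> is put
  back. Otherwise the reversal is put in front and \<open>e\<close> removes it again.\<close>

lemma act_edge_cancel:
  assumes e: "e \<in> edges \<G>" and \<xi>: "\<xi> \<in> boundary \<G> S (rng \<G> e)"
  shows "act_edge \<G> e (act_edge \<G> (bar \<G> e) \<xi>) = \<xi>"
proof (cases "\<xi> 0 = (vone (rng \<G> e), e)")
  case True
  then have "\<xi> (Suc 0) \<noteq> (vone (src \<G> e), bar \<G> e)"
    using \<xi> unfolding boundary_iff admissible_def by (metis snd_conv)
  then show ?thesis using True e case_nat_tl[of \<xi>] src_bar bar_bar by (simp add: act_edge_def)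
next
  case False
  then show ?thesis using e src_bar bar_bar rng_bar by (simp add: act_edge_def)
qed

text \<open>If the first letter cancels against \<open>e\<close>, the element moves through it and
  acts as its image under \<alpha>_e on the tail. Otherwise \<open>rep_emb_mult_one\<close> shows
  that acting first creates no cancellation.\<close>

lemma act_edge_slide:
  assumes e: "e \<in> edges \<G>" and \<xi>: "\<xi> \<in> boundary \<G> S (src \<G> e)" and h: "h \<in> carrier (egrp \<G> e)"
  shows "act_edge \<G> e (act_elt \<G> S (emb \<G> (bar \<G> e) h) \<xi>) = act_elt \<G> S (emb \<G> e h) (act_edge \<G> e \<xi>)"
proof (cases "\<xi> 0 = (vone (src \<G> e), bar \<G> e)")
  case True
  interpret K: group "vgrp \<G> (src \<G> e)" using vgrp_group src_in e by blast
  have "act_elt \<G> S (emb \<G> (bar \<G> e) h) \<xi> =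
      case_nat (vone (src \<G> e), bar \<G> e) (act_elt \<G> S (emb \<G> e h) (\<lambda>n. \<xi> (Suc n)))"
    using act_elt_Cons[of "emb \<G> (bar \<G> e) h" "vone (src \<G> e)" "bar \<G> e" "\<lambda>n. \<xi> (Suc n)"]
      case_nat_tl[of \<xi>] True rep_push_emb[OF bar_in[OF e], of h] h egrp_bar[OF e] rng_bar[OF e]
      bar_bar[OF e] emb_bar_closed[OF e h]
    by simp
  then show ?thesis using True by (simp add: act_edge_def)
next
  case False
  interpret K: group "vgrp \<G> (rng \<G> e)" using vgrp_group rng_in e by blast
  have "act_elt \<G> S (emb \<G> (bar \<G> e) h) \<xi> 0 \<noteq> (vone (src \<G> e), bar \<G> e)"
  proof
    assume *: "act_elt \<G> S (emb \<G> (bar \<G> e) h) \<xi> 0 = (vone (src \<G> e), bar \<G> e)"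
    then have "snd (\<xi> 0) = bar \<G> e" by (metis snd_act_elt snd_conv)
    moreover then have "fst (\<xi> 0) = vone (src \<G> e)"
      using * rep_emb_mult_one[OF bar_in[OF e], of h "fst (\<xi> 0)"] h egrp_bar[OF e] rng_bar[OF e]
        boundary_S[OF \<xi>, of 0]
      by (simp add: act_elt_def)
    ultimately show False using False by (simp add: prod_eq_iff)
  qed
  then show ?thesis using False act_elt_Cons[of "emb \<G> e h" "vone (rng \<G> e)" e \<xi>]
      rep_push_emb[OF e h] emb_closed[OF e h]
    by (simp add: act_edge_def)
qed

section \<open>The action of words and its invariance under the relations\<close>

lemma gwords_Nil [simp]: "([], k) \<in> gwords \<G> x y \<longleftrightarrow> x = y \<and> x \<in> verts \<G> \<and> k \<in> carrier (vgrp \<G> y)"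
  by (auto simp: gwords_def)

lemma gwords_Cons [simp]:
  "((g, e) # p, k) \<in> gwords \<G> x y \<longleftrightarrow> e \<in> edges \<G> \<and> rng \<G> e = x \<and> g \<in> carrier (vgrp \<G> x) \<and>
     (p, k) \<in> gwords \<G> (src \<G> e) y"
  by (auto simp: gwords_def)

lemma act_word_boundary:
  "(p, k) \<in> gwords \<G> x y \<Longrightarrow> \<xi> \<in> boundary \<G> S y \<Longrightarrow> act_word \<G> S (p, k) \<xi> \<in> boundary \<G> S x"
proof (induction p arbitrary: x)
  case Nil
  then show ?case using act_elt_boundary by auto
next
  case (Cons a p)
  then show ?case using act_elt_boundary act_edge_boundary by (cases a) auto
qed

lemma wcat_gwords:
  "(p, g) \<in> gwords \<G> x y \<Longrightarrow> (q, h) \<in> gwords \<G> y z \<Longrightarrow> wcat \<G> y (p, g) (q, h) \<in> gwords \<G> x z"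
proof (induction p arbitrary: x)
  case Nil
  then show ?case using vmult_closed rng_in by (cases q) auto
next
  case (Cons a p)
  obtain s e where a: "a = (s, e)" by (cases a)
  \<comment> \<open>\<open>wcat\<close> distinguishes cases on its second word only, so a letter in
    front of the first word passes through it.\<close>
  have "wcat \<G> y ((s, e) # p, g) (q, h) = (case wcat \<G> y (p, g) (q, h) of (r, k) \<Rightarrow> ((s, e) # r, k))"
    by (cases q) auto
  then show ?case using Cons a by (auto split: prod.splits)
qed

text \<open>The content lies at the junction, where two group elements are multiplied and
  \<open>act_elt_mult\<close> applies.\<close>

lemma act_word_wcat:
  "(p, g) \<in> gwords \<G> x y \<Longrightarrow> (q, h) \<in> gwords \<G> y z \<Longrightarrow> \<xi> \<in> boundary \<G> S z \<Longrightarrow>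
    act_word \<G> S (wcat \<G> y (p, g) (q, h)) \<xi> = act_word \<G> S (p, g) (act_word \<G> S (q, h) \<xi>)"
proof (induction p arbitrary: x)
  case Nil
  show ?case
  proof (cases q)
    case Nil
    then show ?thesis using \<open>([], g) \<in> _\<close> Nil.prems act_elt_mult by auto
  next
    case (Cons b r)
    then show ?thesis
      using Nil.prems act_elt_mult[OF act_edge_boundary[OF _ act_word_boundary]] by (cases b) auto
  qed
next
  case (Cons a p)
  obtain s e where a: "a = (s, e)" by (cases a)
  have "wcat \<G> y ((s, e) # p, g) (q, h) = (case wcat \<G> y (p, g) (q, h) of (r, k) \<Rightarrow> ((s, e) # r, k))"
    by (cases q) auto
  then show ?case using Cons a by (auto split: prod.splits)
qed

text \<open>Rule induction, with \<open>act_edge_cancel\<close>, \<open>act_edge_slide\<close> and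
  \<open>act_word_wcat\<close> for the three essential rules. It makes the action of a class of
  words well defined.\<close>

lemma weq_act_word:
  "weq \<G> x y u w \<Longrightarrow> u \<in> gwords \<G> x y \<and> w \<in> gwords \<G> x y \<and>
     (\<forall>\<xi> \<in> boundary \<G> S y. act_word \<G> S u \<xi> = act_word \<G> S w \<xi>)"
proof (induction rule: weq.induct)
  case (cong x y u u' z w w')
  obtain p g p' g' q h q' h' where uw: "u = (p, g)" "u' = (p', g')" "w = (q, h)" "w' = (q', h')"
    by (metis surj_pair)
  have gw: "(p, g) \<in> gwords \<G> x y" "(p', g') \<in> gwords \<G> x y" "(q, h) \<in> gwords \<G> y z" "(q', h') \<in> gwords \<G> y z"
    using cong uw by auto
  show ?case unfolding uw
  proof (intro conjI ballI)
    fix \<xi> assume \<xi>: "\<xi> \<in> boundary \<G> S z"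
    then show "act_word \<G> S (wcat \<G> y (p, g) (q, h)) \<xi> = act_word \<G> S (wcat \<G> y (p', g') (q', h')) \<xi>"
      using cong gw uw act_word_boundary act_word_wcat by auto
  qed (use gw wcat_gwords in auto)
next
  case (cancel e)
  have "act_word \<G> S ([(vone (rng \<G> e), e), (vone (src \<G> e), bar \<G> e)], vone (rng \<G> e)) \<xi> =
      act_word \<G> S ([], vone (rng \<G> e)) \<xi>" if \<xi>: "\<xi> \<in> boundary \<G> S (rng \<G> e)" for \<xi>
    using act_elt_one[OF \<xi>] act_elt_one[of "act_edge \<G> (bar \<G> e) \<xi>" "src \<G> e"] \<xi>
      act_edge_cancel[OF cancel \<xi>] act_edge_boundary[OF bar_in[OF cancel], of \<xi>] src_bar rng_bar cancel
    by simp
  then show ?case using cancel vone_closed rng_in src_in bar_in rng_bar src_bar by auto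
next
  case (slide e h)
  have "act_word \<G> S ([(vone (rng \<G> e), e)], emb \<G> (bar \<G> e) h) \<xi> =
      act_word \<G> S ([(emb \<G> e h, e)], vone (src \<G> e)) \<xi>" if \<xi>: "\<xi> \<in> boundary \<G> S (src \<G> e)" for \<xi>
    using act_edge_slide[OF slide(1) \<xi> slide(2)] act_elt_one \<xi>
      act_edge_boundary[OF slide(1) \<xi>] emb_closed slide
      act_elt_boundary[OF act_edge_boundary[OF slide(1) \<xi>] emb_closed[OF slide]]
    by simp
  then show ?case using slide vone_closed rng_in src_in emb_closed emb_bar_closed by auto
qed auto

end

section \<open>Minimality in terms of cylinders\<close>

text \<open>A group element changes no edge, and an edge adds or removes one letter at the
  front.\<close>

lemma act_word_eventually:
  "eventually (\<lambda>n. snd (act_word \<G> S w \<xi> n) \<in> A) sequentially \<longleftrightarrow>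
   eventually (\<lambda>n. snd (\<xi> n) \<in> A) sequentially"
proof -
  have tail: "eventually (\<lambda>n. snd (act_edge \<G> e \<xi> n) \<in> A) sequentially \<longleftrightarrow>
    eventually (\<lambda>n. snd (\<xi> n) \<in> A) sequentially" for e \<xi>
  proof (cases "\<xi> 0 = (\<one>\<^bsub>vgrp \<G> (src \<G> e)\<^esub>, bar \<G> e)")
    case True
    then show ?thesis
      using eventually_sequentially_Suc[of "\<lambda>n. snd (\<xi> n) \<in> A"] by (simp add: act_edge_def)
  next
    case False
    then show ?thesis
      using eventually_sequentially_Suc[of "\<lambda>n. snd (act_edge \<G> e \<xi> n) \<in> A"]
      by (simp add: act_edge_def)
  qed
  have elt: "snd (act_elt \<G> S g \<xi> n) = snd (\<xi> n)" for g \<xi> n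
    by (simp add: act_elt_def)
  obtain p k where "w = (p, k)" by (cases w)
  moreover have "eventually (\<lambda>n. snd (act_word \<G> S (p, k) \<xi> n) \<in> A) sequentially \<longleftrightarrow>
      eventually (\<lambda>n. snd (\<xi> n) \<in> A) sequentially"
  proof (induction p)
    case (Cons a p)
    then show ?case by (cases a) (simp add: elt tail)
  qed (simp add: elt)
  ultimately show ?thesis by simp
qed

text \<open>Both sets prescribe initial segments. These conflict unless \<open>\<mu>\<close> is a
  prefix of \<open>\<nu>\<close>, and then the longer prescription implies the shorter one.\<close>

lemma cylinder_Int:
  assumes "length \<mu> \<le> length \<nu>"
  shows "cylinder \<G> S x \<mu> \<inter> cylinder \<G> S x \<nu> \<in> {{}, cylinder \<G> S x \<nu>}"
proof (cases "take (length \<mu>) \<nu> = \<mu>")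
  case True
  have "map \<xi> [0..<length \<mu>] = \<mu>" if "map \<xi> [0..<length \<nu>] = \<nu>" for \<xi>
  proof -
    have "take (length \<mu>) (map \<xi> [0..<length \<nu>]) = \<mu>" using that True by simp
    then show ?thesis using assms by (simp add: take_map)
  qed
  then show ?thesis by (auto simp: cylinder_def)
next
  case False
  have "take (length \<mu>) \<nu> = \<mu>"
    if "map \<xi> [0..<length \<nu>] = \<nu>" "map \<xi> [0..<length \<mu>] = \<mu>" for \<xi>
  proof -
    have "take (length \<mu>) (map \<xi> [0..<length \<nu>]) = \<mu>" using that(2) assms by (simp add: take_map)
    then show ?thesis using that(1) by simp
  qed
  then show ?thesis using False by (auto simp: cylinder_def)
qed

lemma istopology_cylinders:
  "istopology (arbitrary union_of (\<lambda>U. \<exists>\<mu> \<in> gpaths \<G> S x. U = cylinder \<G> S x \<mu>))"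
proof -
  have "(arbitrary union_of (\<lambda>U. \<exists>\<mu> \<in> gpaths \<G> S x. U = cylinder \<G> S x \<mu>))
      (cylinder \<G> S x \<mu> \<inter> cylinder \<G> S x \<nu>)"
    if \<mu>\<nu>: "\<mu> \<in> gpaths \<G> S x" "\<nu> \<in> gpaths \<G> S x" for \<mu> \<nu>
  proof -
    have "cylinder \<G> S x \<mu> \<inter> cylinder \<G> S x \<nu> \<in> {{}, cylinder \<G> S x \<mu>, cylinder \<G> S x \<nu>}"
      using cylinder_Int[of \<mu> \<nu> \<G> S x] cylinder_Int[of \<nu> \<mu> \<G> S x]
      by (cases "length \<mu> \<le> length \<nu>") (auto simp: Int_commute)
    then consider "cylinder \<G> S x \<mu> \<inter> cylinder \<G> S x \<nu> = {}" |
      \<kappa> where "\<kappa> \<in> gpaths \<G> S x" "cylinder \<G> S x \<mu> \<inter> cylinder \<G> S x \<nu> = cylinder \<G> S x \<kappa>"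
      using \<mu>\<nu> by blast
    then show ?thesis by cases (auto intro: arbitrary_union_of_inc)
  qed
  then show ?thesis by (auto simp: istopology_base_eq)
qed

lemma openin_boundary_topology:
  "openin (boundary_topology \<G> S x) U \<longleftrightarrow>
     (\<forall>\<xi> \<in> U. \<exists>\<mu> \<in> gpaths \<G> S x. \<xi> \<in> cylinder \<G> S x \<mu> \<and> cylinder \<G> S x \<mu> \<subseteq> U)"
proof -
  have "openin (boundary_topology \<G> S x) U \<longleftrightarrow>
      (\<exists>\<U>. \<U> \<subseteq> cylinder \<G> S x ` gpaths \<G> S x \<and> \<Union>\<U> = U)"
    unfolding boundary_topology_def topology_inverse'[OF istopology_cylinders]
    by (auto simp: union_of_def arbitrary_def image_def subset_eq)
  also have "\<dots> \<longleftrightarrow> (\<forall>\<xi> \<in> U. \<exists>\<mu> \<in> gpaths \<G> S x. \<xi> \<in> cylinder \<G> S x \<mu> \<and> cylinder \<G> S x \<mu> \<subseteq> U)"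
  proof
    assume r: "\<forall>\<xi> \<in> U. \<exists>\<mu> \<in> gpaths \<G> S x. \<xi> \<in> cylinder \<G> S x \<mu> \<and> cylinder \<G> S x \<mu> \<subseteq> U"
    show "\<exists>\<U>. \<U> \<subseteq> cylinder \<G> S x ` gpaths \<G> S x \<and> \<Union>\<U> = U"
      by (rule exI[of _ "{Z \<in> cylinder \<G> S x ` gpaths \<G> S x. Z \<subseteq> U}"]) (use r in blast)
  qed blast
  finally show ?thesis .
qed

context gog_transversal
begin

lemma topspace_boundary_topology:
  assumes "x \<in> verts \<G>"
  shows "topspace (boundary_topology \<G> S x) = boundary \<G> S x"
proof -
  have "cylinder \<G> S x [] = boundary \<G> S x" by (simp add: cylinder_def)
  then have "openin (boundary_topology \<G> S x) (boundary \<G> S x)"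
    using assms gpaths_Nil by (auto simp: openin_boundary_topology intro!: bexI[of _ "[]"])
  moreover have "U \<subseteq> boundary \<G> S x" if "openin (boundary_topology \<G> S x) U" for U
    using that by (fastforce simp: openin_boundary_topology cylinder_def)
  ultimately show ?thesis by (meson openin_subset openin_topspace subset_antisym)
qed

text \<open>By \<open>weq_act_word\<close> all members of the class send \<xi> to the same point, so
  \<open>the_elem\<close> is applied to a singleton.\<close>

lemma fund_act_class:
  assumes w: "w \<in> gwords \<G> v v" and \<xi>: "\<xi> \<in> boundary \<G> S v"
  shows "fund_act \<G> S (loop_rel \<G> v `` {w}) \<xi> = act_word \<G> S w \<xi>"
proof -
  have "w \<in> loop_rel \<G> v `` {w}" using weq.refl[OF w] by (auto simp: loop_rel_def)
  moreover have "act_word \<G> S w' \<xi> = act_word \<G> S w \<xi>" if "w' \<in> loop_rel \<G> v `` {w}" for w'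
    using that weq_act_word[of v v w w'] \<xi> by (auto simp: loop_rel_def)
  ultimately have "(\<lambda>w. act_word \<G> S w \<xi>) ` (loop_rel \<G> v `` {w}) = {act_word \<G> S w \<xi>}"
    by blast
  then show ?thesis by (simp add: fund_act_def)
qed

lemma orbit_fund_act:
  assumes "\<xi> \<in> boundary \<G> S v"
  shows "orbit (fund_group \<G> v) (fund_act \<G> S) \<xi> = (\<lambda>w. act_word \<G> S w \<xi>) ` gwords \<G> v v"
proof -
  have "orbit (fund_group \<G> v) (fund_act \<G> S) \<xi> =
      (\<lambda>w. fund_act \<G> S (loop_rel \<G> v `` {w}) \<xi>) ` gwords \<G> v v"
    by (auto simp: orbit_def fund_group_def quotient_def)
  then show ?thesis using fund_act_class[OF _ assms] by simp
qed

lemma minimal_action_iff: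
  assumes v: "v \<in> verts \<G>"
  shows "minimal_action (fund_group \<G> v) (boundary_topology \<G> S v) (fund_act \<G> S) \<longleftrightarrow>
    (\<forall>\<xi> \<in> boundary \<G> S v. \<forall>\<mu> \<in> gpaths \<G> S v. cylinder \<G> S v \<mu> \<noteq> {} \<longrightarrow>
      (\<exists>w \<in> gwords \<G> v v. act_word \<G> S w \<xi> \<in> cylinder \<G> S v \<mu>))"
proof -
  let ?T = "boundary_topology \<G> S v"
  have "?T closure_of orbit (fund_group \<G> v) (fund_act \<G> S) \<xi> = topspace ?T \<longleftrightarrow>
    (\<forall>\<mu> \<in> gpaths \<G> S v. cylinder \<G> S v \<mu> \<noteq> {} \<longrightarrow>
      (\<exists>w \<in> gwords \<G> v v. act_word \<G> S w \<xi> \<in> cylinder \<G> S v \<mu>))" (is "?L \<longleftrightarrow> ?R")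
    if \<xi>: "\<xi> \<in> boundary \<G> S v" for \<xi>
  proof -
    have "?L \<longleftrightarrow> (\<forall>\<zeta> \<in> boundary \<G> S v. \<forall>U. \<zeta> \<in> U \<and> openin ?T U \<longrightarrow>
        (\<exists>w \<in> gwords \<G> v v. act_word \<G> S w \<xi> \<in> U))"
      using topspace_boundary_topology[OF v]
      by (auto simp: closure_of_def orbit_fund_act[OF \<xi>])
    also have "\<dots> \<longleftrightarrow> ?R"
    proof
      assume l: "\<forall>\<zeta> \<in> boundary \<G> S v. \<forall>U. \<zeta> \<in> U \<and> openin ?T U \<longrightarrow>
        (\<exists>w \<in> gwords \<G> v v. act_word \<G> S w \<xi> \<in> U)"
      show ?R
      proof (intro ballI impI)
        fix \<mu> assume \<mu>: "\<mu> \<in> gpaths \<G> S v" "cylinder \<G> S v \<mu> \<noteq> {}"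
        then obtain \<zeta> where "\<zeta> \<in> cylinder \<G> S v \<mu>" by blast
        moreover from this have "\<zeta> \<in> boundary \<G> S v" by (simp add: cylinder_def)
        moreover have "openin ?T (cylinder \<G> S v \<mu>)" using \<mu> by (auto simp: openin_boundary_topology)
        ultimately show "\<exists>w \<in> gwords \<G> v v. act_word \<G> S w \<xi> \<in> cylinder \<G> S v \<mu>" using l by blast
      qed
    next
      assume ?R
      then show "\<forall>\<zeta> \<in> boundary \<G> S v. \<forall>U. \<zeta> \<in> U \<and> openin ?T U \<longrightarrow>
          (\<exists>w \<in> gwords \<G> v v. act_word \<G> S w \<xi> \<in> U)"
        unfolding openin_boundary_topology by (metis empty_iff subsetD)
    qed
    finally show ?thesis .
  qed
  then show ?thesis by (simp add: minimal_action_def topspace_boundary_topology[OF v])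
qed

lemma gword_exists:
  assumes "x \<in> verts \<G>" "y \<in> verts \<G>"
  obtains w where "w \<in> gwords \<G> x y"
proof -
  obtain es where es: "is_path \<G> x es y" using connected assms unfolding connected_graph_def by blast
  then have "(map (\<lambda>e. (vone (rng \<G> e), e)) es, vone y) \<in> gwords \<G> x y"
    by (induction es arbitrary: x) (use vone_closed assms rng_in in auto)
  then show thesis using that by blast
qed

section \<open>Traps\<close>

text \<open>Surjectivity leaves 1 as the only representative at the reversed edge, and the reversed
  edge with trivial element may not follow.\<close>

lemma admissible_forward:
  assumes "a \<in> letters" "b \<in> letters" "admissible a b" "emb_onto \<G> (bar \<G> (snd a))"
  shows "snd b \<noteq> bar \<G> (snd a)"
proof
  assume s: "snd b = bar \<G> (snd a)"
  have e: "snd a \<in> edges \<G>" using assms(1) by (simp add: letters_def)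
  have "fst b = vone (src \<G> (snd a))"
    using emb_onto_S[OF bar_in[OF e] assms(4), of "fst b"] assms(2) s rng_bar[OF e]
    by (simp add: letters_def)
  then show False using assms(3) s by (auto simp: admissible_def prod_eq_iff)
qed

text \<open>Nonsingularity provides a point that stays in \<open>A\<close>. Moved to range
  \<open>v\<close>, it has an initial segment that has entered \<open>A\<close>, and every point of
  the corresponding cylinder remains in \<open>A\<close> from there on. The orbit of
  \<open>\<zeta>\<close> misses this cylinder because its tails stay outside
  \<open>A\<close>.\<close>

lemma not_minimal_if_trap:
  assumes ns: "nonsingular \<G>" and v: "v \<in> verts \<G>"
    and A: "f \<in> A" "A \<subseteq> edges \<G>" and onto: "\<And>f. f \<in> A \<Longrightarrow> emb_onto \<G> (bar \<G> f)"
    and closed: "\<And>f f'. f \<in> A \<Longrightarrow> f' \<in> edges \<G> \<Longrightarrow> rng \<G> f' = src \<G> f \<Longrightarrow> f' \<noteq> bar \<G> f \<Longrightarrow> f' \<in> A"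
    and \<zeta>: "\<zeta> \<in> boundary \<G> S y" "\<And>n. snd (\<zeta> n) \<notin> A"
  shows "\<not> minimal_action (fund_group \<G> v) (boundary_topology \<G> S v) (fund_act \<G> S)"
proof
  assume min: "minimal_action (fund_group \<G> v) (boundary_topology \<G> S v) (fund_act \<G> S)"
  let ?X = "{a \<in> letters. snd a \<in> A}"
  have step: "\<exists>b \<in> ?X. admissible a b" if a: "a \<in> ?X" for a
  proof -
    obtain g where g: "g \<in> edges \<G>" "rng \<G> g = src \<G> (snd a)" "g \<noteq> bar \<G> (snd a)"
      using nonsingular_exit[OF ns] a onto A by blast
    then have "(vone (rng \<G> g), g) \<in> ?X" using closed[of "snd a" g] a letter_one[OF g(1)] by simp
    moreover have "admissible a (vone (rng \<G> g), g)" using g by (simp add: admissible_def)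
    ultimately show ?thesis by blast
  qed
  have f: "(vone (rng \<G> f), f) \<in> ?X" using letter_one A by auto
  obtain \<eta>\<^sub>0 where \<eta>\<^sub>0: "\<eta>\<^sub>0 \<in> boundary \<G> S (rng \<G> f)" "\<And>n. \<eta>\<^sub>0 n \<in> ?X"
    using boundary_exists[OF f _ step] by auto
  obtain w where w: "w \<in> gwords \<G> v (rng \<G> f)" using gword_exists v boundary_vert[OF \<eta>\<^sub>0(1)] by blast
  obtain w' where w': "w' \<in> gwords \<G> v y" using gword_exists v boundary_vert[OF \<zeta>(1)] by blast
  let ?\<eta> = "act_word \<G> S w \<eta>\<^sub>0" and ?\<xi> = "act_word \<G> S w' \<zeta>"
  have \<eta>: "?\<eta> \<in> boundary \<G> S v" using act_word_boundary w \<eta>\<^sub>0(1) by (metis surj_pair)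
  have \<xi>: "?\<xi> \<in> boundary \<G> S v" using act_word_boundary w' \<zeta>(1) by (metis surj_pair)
  have "eventually (\<lambda>n. snd (?\<eta> n) \<in> A) sequentially"
    using \<eta>\<^sub>0(2) by (simp add: act_word_eventually)
  \<comment> \<open>The letters contributed by \<open>w\<close> need not lie in \<open>A\<close>, so
    an index \<open>m\<close> past them is chosen. The segment below has length \<open>Suc m\<close>
    in order to fix entry \<open>m\<close> too.\<close>
  then obtain m where m: "snd (?\<eta> m) \<in> A" by (auto simp: eventually_sequentially)
  let ?\<mu> = "map ?\<eta> [0..<Suc m]"
  have "?\<mu> \<in> gpaths \<G> S v" using \<eta> unfolding boundary_def by blast
  moreover have "?\<eta> \<in> cylinder \<G> S v ?\<mu>" using \<eta> by (simp add: cylinder_def)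
  ultimately obtain u where u: "u \<in> gwords \<G> v v" "act_word \<G> S u ?\<xi> \<in> cylinder \<G> S v ?\<mu>"
    using min[unfolded minimal_action_iff[OF v]] \<xi> by blast
  let ?\<theta> = "act_word \<G> S u ?\<xi>"
  have \<theta>: "?\<theta> \<in> boundary \<G> S v" "?\<theta> m = ?\<eta> m" using u(2) by (auto simp: cylinder_def)
  have "snd (?\<theta> n) \<in> A" if "m \<le> n" for n
    using that
  proof (induction n rule: dec_induct)
    case base
    then show ?case using m \<theta> by simp
  next
    case (step n)
    have b: "?\<theta> n \<in> letters" "?\<theta> (Suc n) \<in> letters" "admissible (?\<theta> n) (?\<theta> (Suc n))"
      using \<theta>(1) unfolding boundary_iff by auto
    then have "snd (?\<theta> (Suc n)) \<noteq> bar \<G> (snd (?\<theta> n))" using admissible_forward onto step.IH by blast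
    then show ?case using closed[OF step.IH] b by (auto simp: admissible_def letters_def)
  qed
  then have "eventually (\<lambda>n. snd (?\<theta> n) \<in> A) sequentially" by (auto simp: eventually_sequentially)
  then have "eventually (\<lambda>n. snd (\<zeta> n) \<in> A) sequentially" by (simp add: act_word_eventually)
  then show False using \<zeta>(2) by simp
qed

section \<open>Groupoid orbits and their avoided edges\<close>

definition groupoid_orbit :: "'v \<Rightarrow> (nat \<Rightarrow> 'g \<times> 'e) \<Rightarrow> 'v \<Rightarrow> (nat \<Rightarrow> 'g \<times> 'e) set" where
  "groupoid_orbit v \<xi> x = (\<lambda>w. act_word \<G> S w \<xi>) ` gwords \<G> x v"

definition avoided :: "'v \<Rightarrow> (nat \<Rightarrow> 'g \<times> 'e) \<Rightarrow> 'e set" where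
  "avoided v \<xi> = {f \<in> edges \<G>. \<forall>x. \<forall>\<eta> \<in> groupoid_orbit v \<xi> x. \<not> lies_on f \<eta>}"

context
  fixes v \<xi>
  assumes \<xi>: "\<xi> \<in> boundary \<G> S v"
begin

lemma groupoid_orbit_boundary: "\<eta> \<in> groupoid_orbit v \<xi> x \<Longrightarrow> \<eta> \<in> boundary \<G> S x"
  using act_word_boundary \<xi> by (auto simp: groupoid_orbit_def)

lemma groupoid_orbit_act_elt:
  assumes "\<eta> \<in> groupoid_orbit v \<xi> x" "g \<in> carrier (vgrp \<G> x)"
  shows "act_elt \<G> S g \<eta> \<in> groupoid_orbit v \<xi> x"
proof -
  obtain p k where w: "(p, k) \<in> gwords \<G> x v" "\<eta> = act_word \<G> S (p, k) \<xi>"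
    using assms(1) by (auto simp: groupoid_orbit_def)
  have g: "([], g) \<in> gwords \<G> x x" using assms groupoid_orbit_boundary boundary_vert by auto
  have "act_elt \<G> S g \<eta> = act_word \<G> S (wcat \<G> x ([], g) (p, k)) \<xi>"
    using act_word_wcat[OF g w(1) \<xi>] w(2) by simp
  then show ?thesis using wcat_gwords[OF g w(1)] by (auto simp: groupoid_orbit_def)
qed

lemma groupoid_orbit_act_edge:
  assumes "e \<in> edges \<G>" "\<eta> \<in> groupoid_orbit v \<xi> (src \<G> e)"
  shows "act_edge \<G> e \<eta> \<in> groupoid_orbit v \<xi> (rng \<G> e)"
proof -
  obtain p k where w: "(p, k) \<in> gwords \<G> (src \<G> e) v" "\<eta> = act_word \<G> S (p, k) \<xi>"
    using assms(2) by (auto simp: groupoid_orbit_def)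
  have "act_edge \<G> e \<eta> = act_word \<G> S ((vone (rng \<G> e), e) # p, k) \<xi>"
    using act_elt_one[OF act_edge_boundary] assms groupoid_orbit_boundary w by simp
  moreover have "((vone (rng \<G> e), e) # p, k) \<in> gwords \<G> (rng \<G> e) v"
    using assms w vone_closed rng_in by simp
  ultimately show ?thesis unfolding groupoid_orbit_def by blast
qed

lemma groupoid_orbit_nonempty: "x \<in> verts \<G> \<Longrightarrow> \<exists>\<eta>. \<eta> \<in> groupoid_orbit v \<xi> x"
  using gword_exists boundary_vert[OF \<xi>] unfolding groupoid_orbit_def by (metis imageI)

text \<open>The inverse of the first group element makes the first letter trivial without affecting
  the rest, and the reversed edge then cancels it.\<close>

lemma groupoid_orbit_tl:
  assumes \<eta>: "\<eta> \<in> groupoid_orbit v \<xi> x"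
  shows "(\<lambda>n. \<eta> (Suc n)) \<in> groupoid_orbit v \<xi> (src \<G> (snd (\<eta> 0)))"
proof -
  have b: "\<eta> \<in> boundary \<G> S x" using groupoid_orbit_boundary \<eta> .
  obtain a e where ae: "\<eta> 0 = (a, e)" by (cases "\<eta> 0")
  have e: "e \<in> edges \<G>" "rng \<G> e = x" "a \<in> carrier (vgrp \<G> x)"
    using boundary_edge[OF b, of 0] boundary_rng[OF b] boundary_carrier[OF b, of 0] ae by auto
  interpret K: group "vgrp \<G> x" using vgrp_group boundary_vert[OF b] .
  let ?i = "inv\<^bsub>vgrp \<G> x\<^esub> a"
  have "act_elt \<G> S ?i \<eta> = case_nat (vone x, e) (\<lambda>n. \<eta> (Suc n))"
    using act_elt_Cons[of ?i a e "\<lambda>n. \<eta> (Suc n)"] case_nat_tl[of \<eta>] ae e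
      rep_push_S[OF e(1) S_one[OF e(1)]] act_elt_one[OF boundary_tl[OF b]] by simp
  then have "act_edge \<G> (bar \<G> e) (act_elt \<G> S ?i \<eta>) = (\<lambda>n. \<eta> (Suc n))"
    using e src_bar bar_bar by (simp add: act_edge_def)
  moreover have "act_edge \<G> (bar \<G> e) (act_elt \<G> S ?i \<eta>) \<in> groupoid_orbit v \<xi> (rng \<G> (bar \<G> e))"
    using groupoid_orbit_act_edge[OF bar_in[OF e(1)]] groupoid_orbit_act_elt[OF \<eta>, of ?i] src_bar e by simp
  ultimately show ?thesis using ae rng_bar e by simp
qed

lemma groupoid_orbit_shift: "\<eta> \<in> groupoid_orbit v \<xi> x \<Longrightarrow> (\<lambda>k. \<eta> (n + k)) \<in> groupoid_orbit v \<xi> (rng \<G> (snd (\<eta> n)))"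
proof (induction n)
  case 0
  then show ?case using boundary_rng[OF groupoid_orbit_boundary] by simp
next
  case (Suc n)
  then show ?case using groupoid_orbit_tl[OF Suc.IH[OF Suc.prems]] boundary_src[OF groupoid_orbit_boundary] by simp
qed

text \<open>Admissibility excludes cancellation, so \<open>e\<close> is put in front with trivial
  element. Acting by \<open>g\<close> then only replaces this element, as nothing is pushed on from
  an element of \<open>S e\<close>.\<close>

lemma groupoid_orbit_Cons:
  assumes "a \<in> letters" "\<tau> \<in> groupoid_orbit v \<xi> (src \<G> (snd a))" "admissible a (\<tau> 0)"
  shows "case_nat a \<tau> \<in> groupoid_orbit v \<xi> (rng \<G> (snd a))"
proof -
  obtain g e where a: "a = (g, e)" by (cases a)
  have e: "e \<in> edges \<G>" "g \<in> S e" "g \<in> carrier (vgrp \<G> (rng \<G> e))"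
    using assms(1) S_closed a by (auto simp: letters_def)
  interpret K: group "vgrp \<G> (rng \<G> e)" using vgrp_group rng_in e by blast
  have "\<tau> 0 \<noteq> (vone (src \<G> e), bar \<G> e)" using assms(3) a unfolding admissible_def by auto
  then have "act_edge \<G> e \<tau> = case_nat (vone (rng \<G> e), e) \<tau>" by (simp add: act_edge_def)
  then have "act_elt \<G> S g (act_edge \<G> e \<tau>) = case_nat a \<tau>"
    using act_elt_Cons[of g "vone (rng \<G> e)" e \<tau>] e rep_push_S[OF e(1,2)] a
      act_elt_one[OF groupoid_orbit_boundary[OF assms(2)]] by simp
  then show ?thesis
    using groupoid_orbit_act_elt[OF groupoid_orbit_act_edge[OF e(1)] e(3)] assms(2) a by (metis snd_conv)
qed

lemma groupoid_orbit_append: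
  assumes "\<mu> \<noteq> []" "set \<mu> \<subseteq> letters" "successively admissible \<mu>"
    "\<tau> \<in> groupoid_orbit v \<xi> (src \<G> (snd (last \<mu>)))" "admissible (last \<mu>) (\<tau> 0)"
  shows "\<exists>\<theta> \<in> groupoid_orbit v \<xi> (rng \<G> (snd (hd \<mu>))). map \<theta> [0..<length \<mu>] = \<mu>"
  using assms
proof (induction \<mu>)
  case (Cons a \<mu>)
  show ?case
  proof (cases "\<mu> = []")
    case True
    then show ?thesis using groupoid_orbit_Cons[of a \<tau>] Cons.prems by (intro bexI[of _ "case_nat a \<tau>"]) auto
  next
    case False
    then obtain \<theta> where \<theta>: "\<theta> \<in> groupoid_orbit v \<xi> (rng \<G> (snd (hd \<mu>)))" "map \<theta> [0..<length \<mu>] = \<mu>"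
      using Cons by (auto simp: successively_Cons)
    then have "\<theta> 0 = hd \<mu>" using False by (metis hd_map hd_upt length_greater_0_conv upt_rec list.distinct(1))
    moreover have adm: "admissible a (hd \<mu>)" using Cons.prems False by (simp add: successively_Cons)
    moreover have "rng \<G> (snd (hd \<mu>)) = src \<G> (snd a)" using adm by (simp add: admissible_def)
    ultimately have "case_nat a \<theta> \<in> groupoid_orbit v \<xi> (rng \<G> (snd a))"
      using groupoid_orbit_Cons[of a \<theta>] Cons.prems \<theta> by simp
    moreover have "map (case_nat a \<theta>) [0..<length (a # \<mu>)] = a # \<mu>"
      using \<theta>(2) by (simp add: map_upt_Suc del: upt_Suc)
    ultimately show ?thesis by (metis list.sel(1))
  qed
qed simp

lemma avoided_start:
  assumes f: "f \<in> avoided v \<xi>" and \<eta>: "\<eta> \<in> groupoid_orbit v \<xi> (src \<G> f)"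
  shows "\<eta> 0 = (vone (src \<G> f), bar \<G> f)"
proof (rule ccontr)
  assume "\<not> ?thesis"
  then have "lies_on f (act_edge \<G> f \<eta>)" by (auto simp: lies_on_def act_edge_def intro!: exI[of _ 0])
  then show False using f groupoid_orbit_act_edge[OF _ \<eta>] by (auto simp: avoided_def)
qed

text \<open>A nontrivial representative \<open>s\<close> at the reversed edge would send an orbit
  point to another one whose first letter is nontrivial, contrary to
  \<open>avoided_start\<close>.\<close>

lemma avoided_emb_onto:
  assumes f: "f \<in> avoided v \<xi>"
  shows "emb_onto \<G> (bar \<G> f)"
proof (rule ccontr)
  assume n: "\<not> ?thesis"
  have e: "f \<in> edges \<G>" using f by (simp add: avoided_def)
  interpret K: group "vgrp \<G> (src \<G> f)" using vgrp_group src_in e by blast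
  obtain s where s: "s \<in> S (bar \<G> f)" "s \<noteq> vone (src \<G> f)"
    using not_emb_ontoE[OF bar_in[OF e] n] rng_bar[OF e] by metis
  have sc: "s \<in> carrier (vgrp \<G> (src \<G> f))" using S_closed[OF bar_in[OF e] s(1)] rng_bar[OF e] by simp
  obtain \<eta> where \<eta>: "\<eta> \<in> groupoid_orbit v \<xi> (src \<G> f)" using groupoid_orbit_nonempty src_in e by blast
  have "act_elt \<G> S s \<eta> 0 = (s, bar \<G> f)"
    using avoided_start[OF f \<eta>] rep_push_S(1)[OF bar_in[OF e] s(1)] sc rng_bar[OF e]
    by (simp add: act_elt_def)
  then show False using avoided_start[OF f groupoid_orbit_act_elt[OF \<eta> sc]] s by simp
qed

text \<open>All closure properties follow from \<open>avoided_start\<close>: orbit points with range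
  s(f) exist, and all of them start with the reversal of \<open>f\<close>. A further edge there that
  lies on an orbit point would start a shifted one, and two avoided edges with a common source have
  the same reversal.\<close>

lemma forward_flow_avoided: "forward_flow \<G> (avoided v \<xi>)"
proof
  show "avoided v \<xi> \<subseteq> edges \<G>" by (auto simp: avoided_def)
next
  fix f f' assume f: "f \<in> avoided v \<xi>" and f': "f' \<in> edges \<G>" "rng \<G> f' = src \<G> f" "f' \<noteq> bar \<G> f"
  show "f' \<in> avoided v \<xi>"
  proof (rule ccontr)
    assume "f' \<notin> avoided v \<xi>"
    then obtain x \<eta> n where \<eta>: "\<eta> \<in> groupoid_orbit v \<xi> x" "snd (\<eta> n) = f'"
      using f' by (auto simp: avoided_def lies_on_def)
    have "(\<lambda>k. \<eta> (n + k)) \<in> groupoid_orbit v \<xi> (src \<G> f)" using groupoid_orbit_shift[OF \<eta>(1), of n] \<eta>(2) f' by simp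
    from avoided_start[OF f this] show False using \<eta>(2) f' by simp
  qed
next
  have start: "\<exists>\<eta> \<in> groupoid_orbit v \<xi> (src \<G> f). \<eta> 0 = (vone (src \<G> f), bar \<G> f)" if "f \<in> avoided v \<xi>" for f
    using avoided_start[OF that] groupoid_orbit_nonempty[OF src_in] that by (fastforce simp: avoided_def)
  show "bar \<G> f \<notin> avoided v \<xi>" if f: "f \<in> avoided v \<xi>" for f
  proof -
    obtain \<eta> where "\<eta> \<in> groupoid_orbit v \<xi> (src \<G> f)" "\<eta> 0 = (vone (src \<G> f), bar \<G> f)"
      using start[OF f] by blast
    moreover from this have "lies_on (bar \<G> f) \<eta>" unfolding lies_on_def by (metis snd_conv)
    ultimately show ?thesis by (auto simp: avoided_def)
  qed
  show "inj_on (src \<G>) (avoided v \<xi>)"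
  proof
    fix f f' assume "f \<in> avoided v \<xi>" "f' \<in> avoided v \<xi>" "src \<G> f = src \<G> f'"
    then have "bar \<G> f = bar \<G> f'" using start avoided_start by (metis snd_conv)
    then show "f = f'" using \<open>f \<in> avoided v \<xi>\<close> \<open>f' \<in> avoided v \<xi>\<close> bar_bar by (metis (no_types, lifting) avoided_def mem_Collect_eq)
  qed
qed

text \<open>The last edge of the missed path \<open>\<mu>\<close> is avoided. If it lay on an orbit
  point, the tail after it could be preceded by \<open>\<mu>\<close> instead, because admissibility
  looks only at the edge of the preceding letter; this would be an orbit point in the missed
  cylinder.\<close>

lemma avoided_nonempty:
  assumes \<mu>: "\<mu> \<in> gpaths \<G> S v"
    and miss: "\<And>w. w \<in> gwords \<G> v v \<Longrightarrow> act_word \<G> S w \<xi> \<notin> cylinder \<G> S v \<mu>"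
  shows "avoided v \<xi> \<noteq> {}"
proof -
  have v: "v \<in> verts \<G>" using boundary_vert \<xi> .
  have missO: "\<theta> \<notin> groupoid_orbit v \<xi> v" if "map \<theta> [0..<length \<mu>] = \<mu>" for \<theta>
    using that miss groupoid_orbit_boundary by (fastforce simp: groupoid_orbit_def cylinder_def)
  have ne: "\<mu> \<noteq> []" using missO groupoid_orbit_nonempty[OF v] by auto
  then have \<mu>': "set \<mu> \<subseteq> letters" "rng \<G> (snd (hd \<mu>)) = v" "successively admissible \<mu>"
    using \<mu> gpaths_iff by auto
  let ?f = "snd (last \<mu>)"
  have f: "?f \<in> edges \<G>" using \<mu>'(1) ne last_in_set by (fastforce simp: letters_def)
  have "?f \<in> avoided v \<xi>"
  proof (rule ccontr)
    assume "?f \<notin> avoided v \<xi>"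
    then obtain x \<eta> n where \<eta>: "\<eta> \<in> groupoid_orbit v \<xi> x" "snd (\<eta> n) = ?f"
      using f by (auto simp: avoided_def lies_on_def)
    have "(\<lambda>k. \<eta> (Suc n + k)) \<in> groupoid_orbit v \<xi> (src \<G> ?f)"
      using groupoid_orbit_shift[OF \<eta>(1), of "Suc n"] \<eta>(2) boundary_src[OF groupoid_orbit_boundary[OF \<eta>(1)]] by metis
    moreover have "admissible (last \<mu>) (\<eta> (Suc n + 0))"
    proof -
      have "admissible (\<eta> n) (\<eta> (Suc n))"
        using groupoid_orbit_boundary[OF \<eta>(1)] by (simp add: boundary_iff)
      then show ?thesis unfolding admissible_def \<eta>(2) by auto
    qed
    ultimately show False using groupoid_orbit_append[OF ne \<mu>'(1,3)] \<mu>'(2) missO by blast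
  qed
  then show ?thesis by blast
qed

end

text \<open>\<open>N\<close> is the avoided set of a point whose orbit misses a cylinder. Any orbit
  point with range \<open>x\<close> avoids all of \<open>N\<close> at once.\<close>

lemma flow_if_not_minimal:
  assumes v: "v \<in> verts \<G>"
    and "\<not> minimal_action (fund_group \<G> v) (boundary_topology \<G> S v) (fund_act \<G> S)"
  obtains N where "forward_flow \<G> N" "N \<noteq> {}" "\<And>f. f \<in> N \<Longrightarrow> emb_onto \<G> (bar \<G> f)"
    "\<And>x. x \<in> verts \<G> \<Longrightarrow> \<exists>\<eta> \<in> boundary \<G> S x. \<forall>f \<in> N. \<not> lies_on f \<eta>"
proof -
  obtain \<xi> \<mu> where \<xi>: "\<xi> \<in> boundary \<G> S v" and \<mu>: "\<mu> \<in> gpaths \<G> S v"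
    "\<And>w. w \<in> gwords \<G> v v \<Longrightarrow> act_word \<G> S w \<xi> \<notin> cylinder \<G> S v \<mu>"
    using assms(2) unfolding minimal_action_iff[OF v] by blast
  show thesis
  proof (rule that)
    show "forward_flow \<G> (avoided v \<xi>)" using forward_flow_avoided[OF \<xi>] .
    show "avoided v \<xi> \<noteq> {}" using avoided_nonempty[OF \<xi> \<mu>] .
    show "emb_onto \<G> (bar \<G> f)" if "f \<in> avoided v \<xi>" for f using avoided_emb_onto[OF \<xi> that] .
    show "\<exists>\<eta> \<in> boundary \<G> S x. \<forall>f \<in> avoided v \<xi>. \<not> lies_on f \<eta>" if "x \<in> verts \<G>" for x
      using groupoid_orbit_nonempty[OF \<xi> that] groupoid_orbit_boundary[OF \<xi>] by (fastforce simp: avoided_def)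
  qed
qed

section \<open>Traps from a treelike edge and from a cycle\<close>

lemma not_minimal_if_treelike:
  assumes ns: "nonsingular \<G>" and v: "v \<in> verts \<G>" and e: "e \<in> edges \<G>" "emb_onto \<G> (bar \<G> e)"
    and nc: "\<And>c. minimal_cycle \<G> c \<Longrightarrow> e \<notin> set c" and t: "treelike \<G> e"
    and \<xi>: "\<xi> \<in> boundary \<G> S (rng \<G> e)" "\<not> lies_on e \<xi>"
  shows "\<not> minimal_action (fund_group \<G> v) (boundary_topology \<G> S v) (fund_act \<G> S)"
proof (rule not_minimal_if_trap[OF ns v])
  let ?A = "insert e (branch_edges e)"
  have tree: "is_tree (branch \<G> e)" using t by (simp add: treelike_def)
  \<comment> \<open>A loop is itself a minimal cycle of length 1.\<close>
  have ne: "src \<G> e \<noteq> rng \<G> e"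
  proof
    assume "src \<G> e = rng \<G> e"
    then have "minimal_cycle \<G> [e]"
      using e rng_in by (auto simp: minimal_cycle_def rpaths_def reduced_Cons)
    then show False using nc by force
  qed
  show "e \<in> ?A" by simp
  show "?A \<subseteq> edges \<G>" using e branch_edges_subset by auto
  show "emb_onto \<G> (bar \<G> f)" if "f \<in> ?A" for f
    using that e t points_towards_branch[OF e(1) tree] by (auto simp: treelike_def edges_branch)
  show "f' \<in> ?A" if "f \<in> ?A" "f' \<in> edges \<G>" "rng \<G> f' = src \<G> f" "f' \<noteq> bar \<G> f" for f f'
    using branch_forward[OF e(1) ne that] by simp
  show "\<xi> \<in> boundary \<G> S (rng \<G> e)" by fact
  show "snd (\<xi> n) \<notin> ?A" for n
  proof -
    have "e \<notin> set (map (snd \<circ> \<xi>) [0..<Suc n])" using \<xi>(2) by (auto simp: lies_on_def simp del: upt_Suc)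
    then have "set (map (snd \<circ> \<xi>) [0..<Suc n]) \<inter> branch_edges e = {}"
      using path_avoids_branch[OF e(1) tree nc boundary_path[OF \<xi>(1)]] by blast
    then show ?thesis using \<xi>(2) by (auto simp: lies_on_def)
  qed
qed

text \<open>The trap is the cycle in its given direction, and the point avoiding it runs around the
  cycle in the opposite direction with trivial group elements.\<close>

lemma not_minimal_if_cycle:
  assumes ns: "nonsingular \<G>" and v: "v \<in> verts \<G>" and c: "minimal_cycle \<G> c"
    and all: "edges \<G> = set c \<union> bar \<G> ` set c" and onto: "\<And>e. e \<in> set c \<Longrightarrow> emb_onto \<G> (bar \<G> e)"
  shows "\<not> minimal_action (fund_group \<G> v) (boundary_topology \<G> S v) (fund_act \<G> S)"
proof -
  have ce: "set c \<subseteq> edges \<G>" using all by auto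
  obtain f where f: "f \<in> set c" using c by (cases c) (auto simp: minimal_cycle_def)
  let ?X = "(\<lambda>g. (vone (rng \<G> (bar \<G> g)), bar \<G> g)) ` set c"
  have step: "\<exists>b \<in> ?X. admissible a b" if a: "a \<in> ?X" for a
  proof -
    obtain g where g: "g \<in> set c" "a = (vone (rng \<G> (bar \<G> g)), bar \<G> g)" using a by auto
    \<comment> \<open>The predecessor \<open>h\<close> of \<open>g\<close> on the cycle provides the
      next edge after the reversal of \<open>g\<close>.\<close>
    obtain h where h: "h \<in> set c" "src \<G> h = rng \<G> g" using minimal_cycle_pred c g(1) by blast
    have "bar \<G> h \<noteq> g" using minimal_cycle_bar[OF c h(1)] g(1) by auto
    then have "admissible a (vone (rng \<G> (bar \<G> h)), bar \<G> h)"
      using g h rng_bar[of h] src_bar[of g] bar_bar[of g] subsetD[OF ce] by (simp add: admissible_def)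
    then show ?thesis using h by blast
  qed
  have "?X \<subseteq> letters" using letter_one bar_in ce by auto
  then obtain \<zeta> where \<zeta>: "\<zeta> \<in> boundary \<G> S (rng \<G> (bar \<G> f))" "\<And>n. \<zeta> n \<in> ?X"
    using boundary_exists[OF imageI[OF f] _ step] unfolding snd_conv by blast
  show ?thesis
  proof (rule not_minimal_if_trap[OF ns v f ce onto _ \<zeta>(1)])
    fix g g' assume g: "g \<in> set c" "g' \<in> edges \<G>" "rng \<G> g' = src \<G> g" "g' \<noteq> bar \<G> g"
    show "g' \<in> set c"
    proof (rule ccontr)
      assume "g' \<notin> set c"
      then obtain h where "h \<in> set c" "g' = bar \<G> h" using all g by auto
      moreover from this have "h = g"
        using minimal_cycle_inj_src[OF c] g ce rng_bar by (auto simp: inj_on_def)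
      ultimately show False using g by simp
    qed
  next
    fix n show "snd (\<zeta> n) \<notin> set c" using \<zeta>(2)[of n] minimal_cycle_bar[OF c] by auto
  qed simp
qed

end

theorem theorem5p11:
  fixes \<G> :: "('v, 'e, 'g, 'h) gog"
    and S :: "'e \<Rightarrow> 'g set"
    and v :: 'v
  assumes "graph_of_groups \<G>"
    and "locally_finite \<G>"
    and "nonsingular \<G>"
    and "countable_groups \<G>"
    and "edges \<G> \<noteq> {}"
    and "transversals \<G> S"
    and "v \<in> verts \<G>"
  shows "\<not> minimal_action (fund_group \<G> v) (boundary_topology \<G> S v) (fund_act \<G> S) \<longleftrightarrow>
    (\<exists>e \<in> edges \<G>.
        emb_onto \<G> (bar \<G> e) \<and>
        (\<forall>c. minimal_cycle \<G> c \<longrightarrow> e \<notin> set c) \<and>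
        treelike \<G> e \<and>
        (\<exists>\<xi> \<in> boundary \<G> S (rng \<G> e). \<not> lies_on e \<xi>)) \<or>
    (\<exists>es. minimal_cycle \<G> es \<and>
        edges \<G> = set es \<union> bar \<G> ` set es \<and>
        (\<forall>e \<in> set es. emb_onto \<G> (bar \<G> e)))"
  (is "?L \<longleftrightarrow> ?C \<or> ?D")
proof -
  interpret gog_transversal \<G> S
    using assms by (simp add: gog_transversal_def gog_transversal_axioms_def)
  show ?thesis
  proof
    assume ?L
    then obtain N where N: "forward_flow \<G> N" "N \<noteq> {}" "\<And>f. f \<in> N \<Longrightarrow> emb_onto \<G> (bar \<G> f)"
      "\<And>x. x \<in> verts \<G> \<Longrightarrow> \<exists>\<eta> \<in> boundary \<G> S x. \<forall>f \<in> N. \<not> lies_on f \<eta>"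
      using flow_if_not_minimal[OF \<open>v \<in> verts \<G>\<close>] by blast
    interpret forward_flow \<G> N by fact
    show "?C \<or> ?D"
    \<comment> \<open>The dichotomy between (c') and (d). The return path may be empty, so a loop in
      \<open>N\<close> counts as returning.\<close>
    proof (cases "\<exists>e \<in> N. \<forall>p. is_path \<G> (src \<G> e) p (rng \<G> e) \<longrightarrow> \<not> set p \<subseteq> N")
      case True
      then obtain e where "e \<in> N" "\<And>p. is_path \<G> (src \<G> e) p (rng \<G> e) \<Longrightarrow> \<not> set p \<subseteq> N" by blast
      then interpret forward_no_return \<G> N e by unfold_locales
      have "treelike \<G> e" using is_tree_branch points_towards_forward N(3) by (auto simp: treelike_def)
      moreover have "\<exists>\<xi> \<in> boundary \<G> S (rng \<G> e). \<not> lies_on e \<xi>" using N(4) rng_in e_edge e_N by blast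
      ultimately have ?C using e_edge N(3)[OF e_N] not_on_minimal_cycle by blast
      then show ?thesis ..
    next
      case False
      then have "\<exists>p. is_path \<G> (src \<G> e) p (rng \<G> e) \<and> set p \<subseteq> N" if "e \<in> N" for e
        using that by blast
      then obtain c where "minimal_cycle \<G> c" "edges \<G> = set c \<union> bar \<G> ` set c" "set c \<subseteq> N"
        using minimal_cycle_if_all_return[OF _ connected N(2)] by blast
      then have ?D using N(3) by (intro exI[of _ c]) auto
      then show ?thesis ..
    qed
  next
    assume "?C \<or> ?D"
    then show ?L
    proof (elim disjE bexE exE conjE)
      fix e \<xi> assume "e \<in> edges \<G>" "emb_onto \<G> (bar \<G> e)" "treelike \<G> e"
        "\<forall>c. minimal_cycle \<G> c \<longrightarrow> e \<notin> set c" "\<xi> \<in> boundary \<G> S (rng \<G> e)" "\<not> lies_on e \<xi>"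
      then show ?L using not_minimal_if_treelike[OF assms(3,7)] by metis
    next
      fix c assume "minimal_cycle \<G> c" "edges \<G> = set c \<union> bar \<G> ` set c"
        "\<forall>e \<in> set c. emb_onto \<G> (bar \<G> e)"
      then show ?L using not_minimal_if_cycle[OF assms(3,7)] by metis
    qed
  qed
qed

end
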